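(* Let $2\le p<\infty$. There is a constant $C_p>0$ such that, if $f\in L^1(\mathrm{Conj}(\mathrm{SU}(2)))$ satisfies $\sum_{l\in\frac12\mathbb N_0}(2l+1)^{5p-8}|\widehat f(l)|^p<\infty$, then $f\in L^p(\mathrm{Conj}(\mathrm{SU}(2)))$ and $$\|f\|_{L^p(\mathrm{Conj}(\mathrm{SU}(2)))}\le C_p\left(\sum_{l\in\frac12\mathbb N_0}(2l+1)^{5p-8}\,|\widehat f(l)|^p\right)^{1/p}.$$
   Context: $\mathbb N_0=\{0,1,2,\dots\}$ and $\frac12\mathbb N_0=\{0,\frac12,1,\frac32,\dots\}$. $\mathrm{Conj}(\mathrm{SU}(2))$ is the compact space of conjugacy classes $C_x$ of $\mathrm{SU}(2)$, a commutative compact hypergroup with convolution $\delta_{C_x}*\delta_{C_y}=\int\int\delta_{C_{txt^{-1}sys^{-1}}}\,dt\,ds$ (integrals over $\mathrm{SU}(2)$ with normalized Haar measure). Its Haar measure $\lambda$ is the image of the normalized Haar measure of $\mathrm{SU}(2)$ under $x\mapsto C_x$, and $L^p(\mathrm{Conj}(\mathrm{SU}(2)))=L^p(\lambda)$. It is identified with $[0,1]$, where $t\in[0,1]$ corresponds to the class of $\mathrm{diag}(e^{i\pi t},e^{-i\pi t})$. For $l\in\frac12\mathbb N_0$ let $\psi_l(t)=\frac{\sin((2l+1)\pi t)}{\sin \pi t}$ (the trace of the $(2l+1)$-dimensional irreducible representation of $\mathrm{SU}(2)$, extended continuously to $t=0,1$). The hypergroup characters are $\chi_l=(2l+1)^{-1}\psi_l$,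 and $\widehat f(l)=\int f\,\overline{\chi_l}\,d\lambda$. *)

theory Defs
  imports "HOL-Probability.Probability"
begin

definition adjoint_mat :: "complex^2^2 \<Rightarrow> complex^2^2" where
  "adjoint_mat A = (\<chi> i j. cnj (A $ j $ i))"

definition SU2 :: "(complex^2^2) set" where
  "SU2 = {A. adjoint_mat A ** A = mat 1 \<and> det A = 1}"

definition normalized_haar_SU2 :: "(complex^2^2) measure \<Rightarrow> bool" where
  "normalized_haar_SU2 \<mu> \<longleftrightarrow>
     prob_space \<mu> \<and> sets \<mu> = sets (restrict_space borel SU2) \<and>
     (\<forall>g\<in>SU2. distr \<mu> \<mu> (\<lambda>x. g ** x) = \<mu>)"

definition conj_class :: "complex^2^2 \<Rightarrow> (complex^2^2) set" where
  "conj_class x = {s ** x ** matrix_inv s | s. s \<in> SU2}"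

definition torus :: "real \<Rightarrow> complex^2^2" where
  "torus t = vector [vector [cis (pi * t), 0], vector [0, cis (- (pi * t))]]"

text \<open>The identification of \<open>Conj(SU(2))\<close> with \<open>[0,1]\<close>: every conjugacy class in \<open>SU(2)\<close>
  contains \<open>torus t\<close> for exactly one \<open>t\<close> in \<open>[0,1]\<close>.\<close>

definition class_coord :: "(complex^2^2) set \<Rightarrow> real" where
  "class_coord C = (THE t. t \<in> {0..1} \<and> C = conj_class (torus t))"

text \<open>The Haar measure of the hypergroup \<open>Conj(SU(2))\<close>, as a measure on \<open>[0,1]\<close>: the image of
  the Haar measure of the group under \<open>x \<mapsto> C\<^sub>x\<close>, read in the coordinate above.\<close>

definition conj_haar :: "(complex^2^2) measure \<Rightarrow> real measure" where
  "conj_haar \<mu> = distr \<mu> (restrict_space borel {0..1}) (\<lambda>x. class_coord (conj_class x))"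

definition half_nats :: "real set" where
  "half_nats = {real n / 2 | n :: nat. True}"

definition psi :: "real \<Rightarrow> real \<Rightarrow> real" where
  "psi l t =
     (if t \<in> {0<..<1} then sin ((2 * l + 1) * pi * t) / sin (pi * t)
      else Lim (at t within {0<..<1}) (\<lambda>s. sin ((2 * l + 1) * pi * s) / sin (pi * s)))"

definition hyp_char :: "real \<Rightarrow> real \<Rightarrow> complex" where
  "hyp_char l t = complex_of_real (psi l t / (2 * l + 1))"

definition fourier_coeff :: "real measure \<Rightarrow> (real \<Rightarrow> complex) \<Rightarrow> real \<Rightarrow> complex" where
  "fourier_coeff \<Lambda> f l = (LINT t|\<Lambda>. f t * cnj (hyp_char l t))"

definition Lp_space :: "'a measure \<Rightarrow> real \<Rightarrow> ('a \<Rightarrow> complex) set" where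
  "Lp_space M p = {f \<in> borel_measurable M. integrable M (\<lambda>x. norm (f x) powr p)}"

definition Lp_norm :: "'a measure \<Rightarrow> real \<Rightarrow> ('a \<Rightarrow> complex) \<Rightarrow> real" where
  "Lp_norm M p f = (LINT x|M. norm (f x) powr p) powr (1 / p)"

end

theory Submission
  imports Defs "HOL-Computational_Algebra.Polynomial"
begin

text \<open>
  The weight here is far from critical, which allows a direct argument. Put
  \<open>a n = (n + 1) * \<close> (Fourier coefficient at \<open>l = n / 2\<close>), so that formally \<open>f = (\<Sum>n. a n * \<psi> n)\<close> with
  \<open>\<psi> n\<close> orthonormal and bounded by \<open>n + 1\<close>. On a dyadic block with \<open>n + 1\<close> between \<open>N\<close> and \<open>2 * N\<close>,
  interpolating between the sup bound and Parseval gives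
  \<open>\<parallel>f_N\<parallel>^p \<le> 2^(p-2) * N^(2(p-2)) * (\<Sum>|a n|^p)\<close>, whereas the hypothesis controls the sum with weight
  \<open>N^(4(p-2))\<close>; the surplus geometric factor pays for summing the blocks when \<open>p > 2\<close>, and \<open>p = 2\<close> is
  Parseval. Fatou's lemma along an almost everywhere convergent subsequence of partial sums concludes.

  The orthonormality of the characters is obtained from left invariance alone, without an explicit
  Haar measure or Weyl's integration formula: writing a group element as a unit vector of
  \<open>\<real>^4\<close>, all its components in unit directions have the same distribution, so that
  \<open>E (x0 + t * xj)^(2k) = (1 + t^2)^k * E x0^(2k)\<close>. Comparing the coefficients of \<open>t^2\<close> shows that
  \<open>(1 - x^2) P'' - 3 x P'\<close> has mean zero at \<open>x = x0\<close> for every polynomial \<open>P\<close>, and the Chebyshev polynomials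
  \<open>U_n\<close>, which express the characters in terms of half the trace, are eigenfunctions of this operator.
\<close>

section \<open>Chebyshev polynomials of the second kind\<close>

fun chebyshev_U :: "nat \<Rightarrow> real poly" where
  "chebyshev_U 0 = 1"
| "chebyshev_U (Suc 0) = [:0, 2:]"
| "chebyshev_U (Suc (Suc n)) = [:0, 2:] * chebyshev_U (Suc n) - chebyshev_U n"

lemma poly_chebyshev_U_rec:
  "poly (chebyshev_U (Suc (Suc n))) x = 2 * x * poly (chebyshev_U (Suc n)) x - poly (chebyshev_U n) x"
  by simp

lemma chebyshev_U_cos:
  "poly (chebyshev_U n) (cos \<theta>) * sin \<theta> = sin (real (Suc n) * \<theta>)"
proof (induction n rule: chebyshev_U.induct)
  case (3 n)
  have "poly (chebyshev_U (Suc (Suc n))) (cos \<theta>) * sin \<theta> =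
      2 * cos \<theta> * (poly (chebyshev_U (Suc n)) (cos \<theta>) * sin \<theta>) - poly (chebyshev_U n) (cos \<theta>) * sin \<theta>"
    by (simp add: algebra_simps)
  also have "\<dots> = 2 * cos \<theta> * sin (real (Suc (Suc n)) * \<theta>) - sin (real (Suc (Suc n)) * \<theta> - \<theta>)"
    unfolding 3 by (simp add: algebra_simps)
  also have "\<dots> = sin (real (Suc (Suc n)) * \<theta> + \<theta>)"
    by (simp only: sin_add sin_diff) (simp add: algebra_simps)
  finally show ?case by (simp add: algebra_simps)
qed (simp_all add: sin_double)

text \<open>This is the addition formula for \<open>sin ((n + 2) * \<theta>)\<close> divided by
  \<open>sin \<theta>\<close>. Induction along the recurrence avoids the division, so zeros of the
  sine are covered too.\<close>

lemma chebyshev_U_cos_Suc: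
  "poly (chebyshev_U (Suc n)) (cos \<theta>) =
     cos \<theta> * poly (chebyshev_U n) (cos \<theta>) + cos (real (Suc n) * \<theta>)"
proof (induction n rule: chebyshev_U.induct)
  case 2
  show ?case by (simp add: cos_double_cos power2_eq_square mult.commute[of \<theta>])
next
  case (3 n)
  define c s where "c = cos (real (Suc (Suc n)) * \<theta>)" and "s = sin (real (Suc (Suc n)) * \<theta>)"
  \<comment> \<open>Both neighbouring frequencies are expanded around
    \<open>(n + 2) * \<theta>\<close>; the two cosines add up to
    \<open>2 * c * cos \<theta>\<close>, matching the recurrence.\<close>
  have a: "cos (real (Suc n) * \<theta>) = c * cos \<theta> + s * sin \<theta>"
    unfolding c_def s_def cos_diff[symmetric] by (simp add: algebra_simps)
  have b: "cos (real (Suc (Suc (Suc n))) * \<theta>) = c * cos \<theta> - s * sin \<theta>"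
    unfolding c_def s_def cos_add[symmetric] by (simp add: algebra_simps)
  show ?case
    using 3[folded c_def] unfolding a b poly_chebyshev_U_rec[of "Suc n"] poly_chebyshev_U_rec[of n]
    by algebra
qed simp

text \<open>Each step of the previous formula multiplies by a cosine and adds a cosine, so the bound
  grows by at most 1.\<close>

lemma chebyshev_U_cos_bound: "\<bar>poly (chebyshev_U n) (cos \<theta>)\<bar> \<le> real (Suc n)"
proof (induction n)
  case (Suc n)
  have "\<bar>poly (chebyshev_U (Suc n)) (cos \<theta>)\<bar>
      \<le> \<bar>cos \<theta>\<bar> * \<bar>poly (chebyshev_U n) (cos \<theta>)\<bar> + \<bar>cos (real (Suc n) * \<theta>)\<bar>"
    unfolding chebyshev_U_cos_Suc by (metis abs_mult abs_triangle_ineq)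
  also have "\<dots> \<le> 1 * real (Suc n) + 1"
    by (intro add_mono mult_mono Suc) auto
  finally show ?case by simp
qed simp

text \<open>First-order companion of the differential equation below: it removes the derivative that
  the induction there leaves over.\<close>

lemma pderiv_chebyshev_U:
  "(1 - x\<^sup>2) * poly (pderiv (chebyshev_U n)) x =
     real (n + 2) * x * poly (chebyshev_U n) x - real (n + 1) * poly (chebyshev_U (Suc n)) x"
proof (induction n rule: chebyshev_U.induct)
  case 2
  show ?case by (simp add: pderiv_pCons power2_eq_square algebra_simps)
next
  case (3 n)
  have d: "poly (pderiv (chebyshev_U (Suc (Suc n)))) x = 2 * poly (chebyshev_U (Suc n)) x
      + 2 * x * poly (pderiv (chebyshev_U (Suc n))) x - poly (pderiv (chebyshev_U n)) x"
    by (simp add: pderiv_mult pderiv_diff pderiv_pCons pderiv_smult algebra_simps)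
  have r: "real (Suc (Suc n) + 2) = real n + 4" "real (Suc (Suc n) + 1) = real n + 3"
    "real (Suc n + 2) = real n + 3" "real (Suc n + 1) = real n + 2"
    "real (n + 2) = real n + 2" "real (n + 1) = real n + 1"
    by simp_all
  show ?case
    using 3 unfolding d r poly_chebyshev_U_rec by algebra
qed (simp add: pderiv_1)

text \<open>Inserting the recurrence into the operator leaves
  \<open>4 * (1 - x\<^sup>2) * U' - 6 * x * U\<close> with \<open>U\<close> of index
  \<open>Suc n\<close>, and \<open>pderiv_chebyshev_U\<close> eliminates \<open>U'\<close>. The
  eigenvalue vanishes only for \<open>n = 0\<close>.\<close>

lemma chebyshev_U_ode:
  "(1 - x\<^sup>2) * poly (pderiv (pderiv (chebyshev_U n))) x - 3 * x * poly (pderiv (chebyshev_U n)) x =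
     - (real n * real (n + 2)) * poly (chebyshev_U n) x"
proof (induction n rule: chebyshev_U.induct)
  case 2
  show ?case by (simp add: pderiv_pCons power2_eq_square algebra_simps)
next
  case (3 n)
  have d: "poly (pderiv (chebyshev_U (Suc (Suc n)))) x = 2 * poly (chebyshev_U (Suc n)) x
      + 2 * x * poly (pderiv (chebyshev_U (Suc n))) x - poly (pderiv (chebyshev_U n)) x"
    "poly (pderiv (pderiv (chebyshev_U (Suc (Suc n))))) x =
        4 * poly (pderiv (chebyshev_U (Suc n))) x
      + 2 * x * poly (pderiv (pderiv (chebyshev_U (Suc n)))) x - poly (pderiv (pderiv (chebyshev_U n))) x"
    by (simp_all add: pderiv_mult pderiv_diff pderiv_add pderiv_pCons pderiv_smult algebra_simps)
  have r: "real (Suc (Suc n)) = real n + 2" "real (Suc (Suc n) + 2) = real n + 4"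
    "real (Suc n + 2) = real n + 3" "real (Suc n + 1) = real n + 2" "real (Suc n) = real n + 1"
    "real (n + 2) = real n + 2" "real (n + 1) = real n + 1"
    by simp_all
  show ?case
    using 3 pderiv_chebyshev_U[of x "Suc n"] unfolding d r poly_chebyshev_U_rec by algebra
qed (simp add: pderiv_1)

section \<open>Conjugacy classes of SU(2)\<close>

text \<open>A matrix in SU(2) is determined by its first column \<open>(a, b)\<close>, a unit vector
  of C^2; this is the picture of unit quaternions.\<close>

definition su2 :: "complex \<Rightarrow> complex \<Rightarrow> complex^2^2" where
  "su2 a b = vector [vector [a, - cnj b], vector [b, cnj a]]"

lemma su2_nth [simp]: "su2 a b $ 1 $ 1 = a" "su2 a b $ 2 $ 1 = b"
  "su2 a b $ 1 $ 2 = - cnj b" "su2 a b $ 2 $ 2 = cnj a"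
  by (simp_all add: su2_def)

lemma matrix_2_eq_iff:
  fixes A B :: "'a^2^2"
  shows "A = B \<longleftrightarrow> A$1$1 = B$1$1 \<and> A$1$2 = B$1$2 \<and> A$2$1 = B$2$1 \<and> A$2$2 = B$2$2"
  by (auto simp: vec_eq_iff forall_2)

lemma matrix_mult_2_nth:
  fixes A B :: "'a::semiring_1^2^2"
  shows "(A ** B) $ i $ j = A $ i $ 1 * B $ 1 $ j + A $ i $ 2 * B $ 2 $ j"
  by (simp add: matrix_matrix_mult_def sum_2)

lemma su2_mult: "su2 a b ** su2 c d = su2 (a * c - cnj b * d) (b * c + cnj a * d)"
  by (simp add: matrix_2_eq_iff matrix_mult_2_nth algebra_simps)

lemma su2_1: "mat 1 = su2 1 0"
  by (simp add: matrix_2_eq_iff mat_def)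

lemma adjoint_su2: "adjoint_mat (su2 a b) = su2 (cnj a) (- b)"
  by (simp add: matrix_2_eq_iff adjoint_mat_def)

lemma torus_eq_su2: "torus t = su2 (cis (pi * t)) 0"
  by (simp add: matrix_2_eq_iff torus_def cis_cnj)

lemma SU2_iff: "A \<in> SU2 \<longleftrightarrow> (\<exists>a b. A = su2 a b \<and> a * cnj a + b * cnj b = 1)"
proof
  assume "A \<in> SU2"
  define a b c d where "a = A$1$1" and "b = A$2$1" and "c = A$1$2" and "d = A$2$2"
  have *: "adjoint_mat A ** A = mat 1" "det A = 1"
    using \<open>A \<in> SU2\<close> by (auto simp: SU2_def)
  have 1: "cnj a * a + cnj b * b = 1" "cnj a * c + cnj b * d = 0" "a * d - c * b = 1"
    using * by (simp_all add: matrix_2_eq_iff matrix_mult_2_nth adjoint_mat_def mat_def det_2 a_def b_def c_def d_def)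
  \<comment> \<open>The last two equations are linear in \<open>c\<close> and \<open>d\<close> with
    determinant |a|^2 + |b|^2 = 1, so they determine both.\<close>
  have "d = cnj a" "c = - cnj b"
    using 1 by algebra+
  hence "A = su2 a b"
    by (simp add: matrix_2_eq_iff flip: a_def b_def c_def d_def)
  thus "\<exists>a b. A = su2 a b \<and> a * cnj a + b * cnj b = 1"
    using 1 by (metis mult.commute)
next
  assume "\<exists>a b. A = su2 a b \<and> a * cnj a + b * cnj b = 1"
  then obtain a b where A: "A = su2 a b" "a * cnj a + b * cnj b = 1" by blast
  thus "A \<in> SU2"
    by (auto simp: SU2_def adjoint_su2 su2_mult su2_1 det_2 algebra_simps)
qed

lemma su2_in_SU2: "a * cnj a + b * cnj b = 1 \<Longrightarrow> su2 a b \<in> SU2"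
  unfolding SU2_iff by blast

lemma cmod_su2:
  assumes "a * cnj a + b * cnj b = 1"
  shows "(cmod a)\<^sup>2 + (cmod b)\<^sup>2 = 1"
proof -
  have "complex_of_real ((cmod a)\<^sup>2 + (cmod b)\<^sup>2) = 1"
    using assms by (simp only: of_real_add complex_norm_square)
  thus ?thesis by (simp only: of_real_eq_1_iff)
qed

lemma SU2_mult:
  assumes "A \<in> SU2" "B \<in> SU2"
  shows "A ** B \<in> SU2"
proof -
  obtain a b c d where AB: "A = su2 a b" "a * cnj a + b * cnj b = 1" "B = su2 c d" "c * cnj c + d * cnj d = 1"
    using assms unfolding SU2_iff by blast
  have "(a * c - cnj b * d) * cnj (a * c - cnj b * d) + (b * c + cnj a * d) * cnj (b * c + cnj a * d)
     = (a * cnj a + b * cnj b) * (c * cnj c + d * cnj d)"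
    by (simp add: algebra_simps)
  also have "\<dots> = 1" by (simp add: AB)
  finally show ?thesis unfolding AB su2_mult SU2_iff by blast
qed

lemma SU2_adjoint:
  assumes "A \<in> SU2"
  shows "adjoint_mat A \<in> SU2" "A ** adjoint_mat A = mat 1" "adjoint_mat A ** A = mat 1"
proof -
  obtain a b where A: "A = su2 a b" "a * cnj a + b * cnj b = 1"
    using assms unfolding SU2_iff by blast
  thus "A ** adjoint_mat A = mat 1" "adjoint_mat A ** A = mat 1"
    by (simp_all add: adjoint_su2 su2_mult su2_1 algebra_simps)
  have "cnj a * cnj (cnj a) + (- b) * cnj (- b) = 1"
    using A by (simp add: algebra_simps)
  thus "adjoint_mat A \<in> SU2" unfolding A adjoint_su2 SU2_iff by blast
qed

lemma matrix_inv_SU2: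
  assumes "A \<in> SU2"
  shows "matrix_inv A = adjoint_mat A"
proof -
  have "\<exists>B. A ** B = mat 1 \<and> B ** A = mat 1"
    using SU2_adjoint(2,3)[OF assms] by blast
  from someI_ex[OF this] have "A ** matrix_inv A = mat 1"
    unfolding matrix_inv_def by blast
  hence "adjoint_mat A ** (A ** matrix_inv A) = adjoint_mat A"
    by simp
  thus ?thesis
    by (simp add: matrix_mul_assoc SU2_adjoint(3)[OF assms])
qed

section \<open>Conjugation, diagonalization and the class coordinate\<close>

lemma adjoint_mult: "adjoint_mat (A ** B) = adjoint_mat B ** adjoint_mat A"
  by (simp add: matrix_2_eq_iff adjoint_mat_def matrix_mult_2_nth algebra_simps)

text \<open>The relation \<open>x ** s = s ** y\<close> is conjugacy written without an inverse, the
  form in which an eigenvector computation delivers it. The two orbits differ by shifting the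
  conjugating element by \<open>s\<close>.\<close>

lemma conj_class_conjugate:
  assumes s: "s \<in> SU2" and x: "x ** s = s ** y"
  shows "conj_class x = conj_class y"
proof -
  have y: "y = adjoint_mat s ** x ** s"
    by (metis x SU2_adjoint(3)[OF s] matrix_mul_assoc matrix_mul_lid)
  have x': "x = s ** y ** adjoint_mat s"
    by (metis x SU2_adjoint(2)[OF s] matrix_mul_assoc matrix_mul_rid)
  show ?thesis
  proof (intro equalityI subsetI)
    fix z assume "z \<in> conj_class x"
    then obtain r where r: "r \<in> SU2" "z = r ** x ** adjoint_mat r"
      unfolding conj_class_def using matrix_inv_SU2 by auto
    have "z = (r ** s) ** y ** adjoint_mat (r ** s)"
      unfolding r(2) by (subst x') (simp add: adjoint_mult matrix_mul_assoc)
    thus "z \<in> conj_class y"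
      unfolding conj_class_def using SU2_mult[OF r(1) s] matrix_inv_SU2 by force
  next
    fix z assume "z \<in> conj_class y"
    then obtain r where r: "r \<in> SU2" "z = r ** y ** adjoint_mat r"
      unfolding conj_class_def using matrix_inv_SU2 by auto
    have ss: "adjoint_mat (adjoint_mat s) = s"
      by (simp add: matrix_2_eq_iff adjoint_mat_def)
    have "z = (r ** adjoint_mat s) ** x ** adjoint_mat (r ** adjoint_mat s)"
      unfolding r(2) by (subst y) (simp add: adjoint_mult matrix_mul_assoc ss)
    thus "z \<in> conj_class x"
      unfolding conj_class_def
      using SU2_mult[OF r(1) SU2_adjoint(1)[OF s]] matrix_inv_SU2 by force
  qed
qed

text \<open>The diagonal entries of a matrix in SU(2) are complex conjugates, so this real part is
  half the trace, a class function.\<close>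

lemma Re_conj_class:
  assumes "x \<in> SU2" "y \<in> conj_class x"
  shows "Re (y $ 1 $ 1) = Re (x $ 1 $ 1)"
proof -
  obtain a b where x: "x = su2 a b" using assms unfolding SU2_iff by blast
  obtain s where s: "s \<in> SU2" "y = s ** x ** adjoint_mat s"
    using assms matrix_inv_SU2 unfolding conj_class_def by auto
  obtain c d where cd: "s = su2 c d" "c * cnj c + d * cnj d = 1"
    using s unfolding SU2_iff by blast
  \<comment> \<open>The bracket is a number minus its conjugate, hence has real part 0.\<close>
  have "y $ 1 $ 1 = c * cnj c * a + d * cnj d * cnj a + (cnj b * c * d - cnj (cnj b * c * d))"
    by (simp add: s cd x adjoint_su2 su2_mult algebra_simps)
  also have "Re \<dots> = Re (c * cnj c + d * cnj d) * Re a"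
    by (simp add: algebra_simps)
  finally show ?thesis by (simp add: x cd)
qed

lemma mem_conj_class: "x \<in> conj_class x"
proof -
  have 1: "mat 1 \<in> SU2" unfolding su2_1 by (rule su2_in_SU2) simp
  have "x = mat 1 ** x ** matrix_inv (mat 1)"
    unfolding matrix_inv_SU2[OF 1] by (simp add: su2_1 adjoint_su2) (simp flip: su2_1)
  thus ?thesis unfolding conj_class_def using 1 by blast
qed

lemma Re_SU2_bound:
  assumes "x \<in> SU2"
  shows "\<bar>Re (x $ 1 $ 1)\<bar> \<le> 1"
proof -
  obtain a b where x: "x = su2 a b" "a * cnj a + b * cnj b = 1" using assms unfolding SU2_iff by blast
  note ab = cmod_su2[OF x(2)]
  from ab have "cmod a \<le> 1" by (smt (verit) zero_le_power2 power2_le_imp_le one_power2)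
  thus ?thesis using abs_Re_le_cmod[of a] by (simp add: x)
qed

text \<open>The eigenvalues are \<open>cis \<theta>\<close> and \<open>cis (- \<theta>)\<close> with
  \<open>cos \<theta>\<close> half the trace; \<open>arccos\<close> picks the one in the closed
  upper half plane, which \<open>torus\<close> puts first.\<close>

lemma SU2_diagonalize:
  assumes x: "x \<in> SU2"
  obtains s where "s \<in> SU2" "x ** s = s ** torus (arccos (Re (x $ 1 $ 1)) / pi)"
proof -
  obtain a b where x: "x = su2 a b" "a * cnj a + b * cnj b = 1" using x unfolding SU2_iff by blast
  note ab = cmod_su2[OF x(2)]
  define S where "S = sqrt (1 - (Re a)\<^sup>2)"
  define z where "z = cis (arccos (Re a))"
  have "\<bar>Re a\<bar> \<le> 1" using Re_SU2_bound[OF assms] by (simp add: x)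
  have S2: "S\<^sup>2 = (Im a)\<^sup>2 + (cmod b)\<^sup>2"
    using ab real_sqrt_pow2[of "1 - (Re a)\<^sup>2"] \<open>\<bar>Re a\<bar> \<le> 1\<close> unfolding S_def abs_square_le_1[symmetric]
    by (simp add: cmod_power2)
  have z: "z = Complex (Re a) S"
    using \<open>\<bar>Re a\<bar> \<le> 1\<close> unfolding z_def S_def by (simp add: complex_eq_iff cos_arccos_abs sin_arccos_abs)
  have torus: "torus (arccos (Re (x $ 1 $ 1)) / pi) = su2 z 0"
    by (simp add: torus_eq_su2 x z_def)
  have z1: "z * cnj z = 1" by (simp add: z_def cis_cnj cis_mult)
  have az: "a + cnj a = z + cnj z" by (simp add: z complex_eq_iff)
  \<comment> \<open>The columns of \<open>s\<close> are a unit eigenvector for \<open>z\<close> and its quaternionic conjugate.\<close>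
  show thesis
  proof (cases "b = 0")
    \<comment> \<open>The matrix is already diagonal: \<open>s\<close> is the identity, or swaps the
      axes when \<open>z\<close> is the second entry.\<close>
    case True
    have "S \<ge> 0" using \<open>\<bar>Re a\<bar> \<le> 1\<close> by (simp add: S_def abs_square_le_1)
    moreover have "S\<^sup>2 = \<bar>Im a\<bar>\<^sup>2" using True S2 by simp
    ultimately have "S = \<bar>Im a\<bar>" using power2_eq_imp_eq abs_ge_zero by blast
    hence "z = a \<or> z = cnj a"
      by (cases "Im a \<ge> 0") (simp_all add: z complex_eq_iff)
    thus thesis
    proof
      assume "z = a"
      moreover have "su2 1 0 \<in> SU2" by (rule su2_in_SU2) simp
      ultimately show thesis using that[of "su2 1 0"] True unfolding torus by (simp add: x su2_mult)
    next
      assume "z = cnj a"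
      moreover have "su2 0 1 \<in> SU2" by (rule su2_in_SU2) simp
      ultimately show thesis using that[of "su2 0 1"] True unfolding torus by (simp add: x su2_mult)
    qed
  next
    case False
    \<comment> \<open>The first row of \<open>x - z\<close> annihilates
      \<open>(cnj b, a - z)\<close>; \<open>r\<close> is the length of this vector and is positive
      because \<open>b\<close> is not 0.\<close>
    define r where "r = sqrt ((cmod b)\<^sup>2 + (cmod (a - z))\<^sup>2)"
    have r: "r > 0" using False unfolding r_def by (intro real_sqrt_gt_zero add_pos_nonneg) auto
    have r2: "of_real r * of_real r = b * cnj b + (a - z) * cnj (a - z)"
      unfolding complex_norm_square[symmetric] of_real_mult[symmetric] of_real_add[symmetric] of_real_eq_iff
        r_def by (simp add: power2_eq_square[symmetric])
    define s where "s = su2 (cnj b / of_real r) ((a - z) / of_real r)"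
    have "cnj b / of_real r * cnj (cnj b / of_real r) + (a - z) / of_real r * cnj ((a - z) / of_real r)
       = (b * cnj b + (a - z) * cnj (a - z)) / (of_real r * of_real r)"
      by (simp add: add_divide_distrib mult.commute)
    also have "\<dots> = 1" unfolding r2[symmetric] using r by simp
    finally have "s \<in> SU2" unfolding s_def SU2_iff by blast
    \<comment> \<open>The second row of the eigenvalue equation amounts to the characteristic
      equation \<open>z\<^sup>2 - (a + cnj a) * z + 1 = 0\<close>.\<close>
    moreover have "b * cnj b + cnj a * (a - z) = (a * cnj a + b * cnj b) - (a + cnj a) * z + a * z"
      by (simp add: algebra_simps)
    hence "b * cnj b + cnj a * (a - z) = (a - z) * z"
      unfolding x(2) az using z1 by (simp add: algebra_simps)
    hence "x ** s = s ** su2 z 0"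
      unfolding s_def x su2_mult using r
      by (simp add: matrix_2_eq_iff right_diff_distrib flip: diff_divide_distrib add_divide_distrib)
    ultimately show thesis using that unfolding torus by blast
  qed
qed

lemma torus_SU2: "torus t \<in> SU2"
  unfolding torus_eq_su2 by (rule su2_in_SU2) (simp add: cis_cnj cis_mult)

text \<open>Diagonalization gives existence for the definite description; the trace gives
  uniqueness, because the cosine is injective on [0, pi].\<close>

lemma class_coord_conj_class:
  assumes x: "x \<in> SU2"
  shows "class_coord (conj_class x) = arccos (Re (x $ 1 $ 1)) / pi"
proof -
  have b: "-1 \<le> Re (x $ 1 $ 1)" "Re (x $ 1 $ 1) \<le> 1"
    using Re_SU2_bound[OF x] by auto
  obtain s where "s \<in> SU2" "x ** s = s ** torus (arccos (Re (x $ 1 $ 1)) / pi)"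
    using SU2_diagonalize[OF x] .
  hence "conj_class x = conj_class (torus (arccos (Re (x $ 1 $ 1)) / pi))"
    by (rule conj_class_conjugate)
  moreover have "t = arccos (Re (x $ 1 $ 1)) / pi" if t: "t \<in> {0..1}" "conj_class x = conj_class (torus t)" for t
  proof -
    have "Re (x $ 1 $ 1) = Re (torus t $ 1 $ 1)"
      using mem_conj_class[of x] unfolding t(2) by (rule Re_conj_class[OF torus_SU2])
    hence "Re (x $ 1 $ 1) = cos (pi * t)" by (simp add: torus_eq_su2)
    moreover have "0 \<le> pi * t" "pi * t \<le> pi" using t(1) by (auto simp: mult_left_le)
    ultimately show ?thesis by (simp add: arccos_cos)
  qed
  ultimately show ?thesis
    unfolding class_coord_def using b arccos_lbound[OF b] arccos_ubound[OF b]
    by (intro the_equality) (auto simp: divide_le_eq)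
qed

section \<open>The distribution of the trace\<close>

lemma coeff_power_one_plus_square:
  "coeff ([:1, 0, 1:] ^ j :: real poly) 0 = 1"
  "coeff ([:1, 0, 1:] ^ j :: real poly) (Suc 0) = 0"
  "coeff ([:1, 0, 1:] ^ j :: real poly) (Suc (Suc 0)) = real j"
  by (induction j) (simp_all add: coeff_pCons)

text \<open>An identity valid for all real \<open>t\<close> is an identity of polynomials, so the
  coefficients of t^2 may be compared.\<close>

lemma coeff_two_power_one_plus_square:
  fixes c :: "nat \<Rightarrow> real"
  assumes eq: "\<And>t. (\<Sum>i\<le>n. c i * t ^ i) = m * (1 + t\<^sup>2) ^ j" and "2 \<le> n"
  shows "c 2 = m * real j"
proof -
  have "poly (\<Sum>i\<le>n. monom (c i) i) = poly (smult m ([:1, 0, 1:] ^ j))"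
    using eq by (simp add: fun_eq_iff poly_sum poly_monom power2_eq_square)
  hence "(\<Sum>i\<le>n. monom (c i) i) = smult m ([:1, 0, 1:] ^ j)"
    by (simp add: poly_eq_poly_eq_iff)
  hence "coeff (\<Sum>i\<le>n. monom (c i) i) 2 = coeff (smult m ([:1, 0, 1:] ^ j)) 2"
    by simp
  thus ?thesis using \<open>2 \<le> n\<close>
    by (simp add: coeff_sum numeral_2_eq_2 coeff_power_one_plus_square)
qed

locale haar_SU2 =
  fixes \<mu> :: "(complex^2^2) measure"
  assumes haar: "normalized_haar_SU2 \<mu>"
begin

sublocale prob_space \<mu>
  using haar by (simp add: normalized_haar_SU2_def)

lemma sets_haar [measurable_cong]: "sets \<mu> = sets (restrict_space borel SU2)"
  using haar by (simp add: normalized_haar_SU2_def)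

lemma space_haar: "space \<mu> = SU2"
  using sets_eq_imp_space_eq[OF sets_haar] by (simp add: space_restrict_space)

lemma measurable_entry [measurable]: "(\<lambda>x. x $ i $ j) \<in> borel_measurable \<mu>"
  unfolding measurable_cong_sets[OF sets_haar refl]
  by (intro borel_measurable_continuous_on_restrict continuous_intros)

lemma measurable_mult: "g \<in> SU2 \<Longrightarrow> (\<lambda>x. g ** x) \<in> measurable \<mu> \<mu>"
  unfolding measurable_cong_sets[OF sets_haar sets_haar] matrix_matrix_mult_def
  by (intro measurable_restrict_space2 borel_measurable_continuous_on_restrict continuous_intros)
    (auto simp: space_restrict_space SU2_mult simp flip: matrix_matrix_mult_def)

lemma integral_mult_left:
  fixes F :: "complex^2^2 \<Rightarrow> real"
  assumes "g \<in> SU2" and [measurable]: "F \<in> borel_measurable \<mu>"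
  shows "(\<integral>x. F (g ** x) \<partial>\<mu>) = (\<integral>x. F x \<partial>\<mu>)"
proof -
  have "distr \<mu> \<mu> (\<lambda>x. g ** x) = \<mu>"
    using haar assms by (simp add: normalized_haar_SU2_def)
  thus ?thesis
    using integral_distr[OF measurable_mult[OF assms(1)] assms(2)] by simp
qed

text \<open>The coordinates that identify SU(2) with the unit sphere of \<open>\<real>^4\<close>; \<open>X 0\<close> is half the trace.\<close>

definition X :: "nat \<Rightarrow> complex^2^2 \<Rightarrow> real" where
  "X j x = (if j = 0 then Re (x $ 1 $ 1) else if j = 1 then Im (x $ 1 $ 1)
            else if j = 2 then Re (x $ 2 $ 1) else Im (x $ 2 $ 1))"

lemma measurable_X [measurable]: "X j \<in> borel_measurable \<mu>"
  unfolding X_def by measurable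

lemma sum_X_squares:
  assumes "x \<in> SU2"
  shows "(X 0 x)\<^sup>2 + (X 1 x)\<^sup>2 + (X 2 x)\<^sup>2 + (X 3 x)\<^sup>2 = 1"
proof -
  obtain a b where x: "x = su2 a b" "a * cnj a + b * cnj b = 1"
    using assms unfolding SU2_iff by blast
  show ?thesis
    using cmod_su2[OF x(2)] by (simp add: X_def x(1) cmod_power2)
qed

lemma X_bound: "x \<in> SU2 \<Longrightarrow> \<bar>X j x\<bar> \<le> 1"
proof -
  assume x: "x \<in> SU2"
  have "X j x = X 0 x \<or> X j x = X 1 x \<or> X j x = X 2 x \<or> X j x = X 3 x"
    by (simp add: X_def)
  hence "(X j x)\<^sup>2 \<le> (X 0 x)\<^sup>2 + (X 1 x)\<^sup>2 + (X 2 x)\<^sup>2 + (X 3 x)\<^sup>2"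
    by (elim disjE) simp_all
  hence "(X j x)\<^sup>2 \<le> 1"
    unfolding sum_X_squares[OF x] .
  thus ?thesis by (simp add: abs_square_le_1)
qed

lemma integrable_X_power: "integrable \<mu> (\<lambda>x. X i x ^ k * X j x ^ l)"
proof (rule integrable_const_bound)
  show "AE x in \<mu>. norm (X i x ^ k * X j x ^ l) \<le> 1"
    by (intro AE_I2) (auto simp: space_haar abs_mult power_abs intro!: mult_le_one power_le_one X_bound)
qed measurable

lemma integrable_X_power_single: "integrable \<mu> (\<lambda>x. X i x ^ k)"
  using integrable_X_power[of i k i 0] by simp

text \<open>Left multiplication by a suitable group element turns the first coordinate into the
  component along the unit vector \<open>(c, s)\<close> in the plane of coordinates 0 and
  \<open>j\<close>; invariance does the rest.\<close>

lemma integral_rotate: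
  fixes F :: "real \<Rightarrow> real"
  assumes [measurable]: "F \<in> borel_measurable borel" and "c\<^sup>2 + s\<^sup>2 = 1" "j \<in> {1, 2, 3}"
  shows "(\<integral>x. F (c * X 0 x + s * X j x) \<partial>\<mu>) = (\<integral>x. F (X 0 x) \<partial>\<mu>)"
proof -
  \<comment> \<open>The (1,1) entry of the product is
    \<open>\<alpha> * x $ 1 $ 1 - cnj \<beta> * x $ 2 $ 1\<close>; the values are chosen so that its
    real part is \<open>c * X 0 x + s * X j x\<close>.\<close>
  define \<alpha> \<beta> where "\<alpha> = Complex c (if j = 1 then - s else 0)"
    and "\<beta> = (if j = 1 then 0 else if j = 2 then Complex (- s) 0 else Complex 0 (- s))"
  have "\<alpha> * cnj \<alpha> + \<beta> * cnj \<beta> = 1"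
    using assms(2) by (simp add: \<alpha>_def \<beta>_def complex_eq_iff power2_eq_square)
  hence g: "su2 \<alpha> \<beta> \<in> SU2" by (rule su2_in_SU2)
  have "X 0 (su2 \<alpha> \<beta> ** x) = c * X 0 x + s * X j x" for x
    using assms(3) by (auto simp: X_def matrix_mult_2_nth \<alpha>_def \<beta>_def)
  thus ?thesis
    using integral_mult_left[OF g, of "\<lambda>x. F (X 0 x)"] by simp
qed

section \<open>Moments of half the trace\<close>

definition m :: "nat \<Rightarrow> real" where "m k = (\<integral>x. X 0 x ^ k \<partial>\<mu>)"

text \<open>The rotation with \<open>c = -1\<close>, \<open>s = 0\<close> shows that
  \<open>X 0\<close> is distributed symmetrically about 0.\<close>

lemma m_odd: "odd k \<Longrightarrow> m k = 0"
  using integral_rotate[of "\<lambda>y. y ^ k" "-1" 0 1] by (simp add: m_def power_minus_odd)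

text \<open>Both sides are the coefficient of t^2 in the moment of \<open>X 0 x + t * X j x\<close>
  of order \<open>2 * Suc k\<close>, computed by binomial expansion and by rotation.\<close>

lemma mixed_moment:
  assumes j: "j \<in> {1, 2, 3}"
  shows "real (2 * Suc k choose 2) * (\<integral>x. X 0 x ^ (2 * k) * X j x ^ 2 \<partial>\<mu>) = m (2 * Suc k) * real (Suc k)"
proof -
  define n where "n = 2 * Suc k"
  have "(\<Sum>i\<le>n. real (n choose i) * (\<integral>x. X 0 x ^ (n - i) * X j x ^ i \<partial>\<mu>) * t ^ i)
      = m n * (1 + t\<^sup>2) ^ Suc k" for t :: real
  proof -
    \<comment> \<open>Dividing by \<open>r\<close> makes \<open>(1, t)\<close> a unit vector, as
      \<open>integral_rotate\<close> requires.\<close>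
    define r where "r = sqrt (1 + t\<^sup>2)"
    have r: "r > 0" "r\<^sup>2 = 1 + t\<^sup>2"
      unfolding r_def by (auto intro: add_pos_nonneg)
    have "(\<Sum>i\<le>n. real (n choose i) * (\<integral>x. X 0 x ^ (n - i) * X j x ^ i \<partial>\<mu>) * t ^ i)
       = (\<Sum>i\<le>n. \<integral>x. real (n choose i) * t ^ i * (X 0 x ^ (n - i) * X j x ^ i) \<partial>\<mu>)"
      by (intro sum.cong) simp_all
    also have "\<dots> = (\<integral>x. (\<Sum>i\<le>n. real (n choose i) * t ^ i * (X 0 x ^ (n - i) * X j x ^ i)) \<partial>\<mu>)"
      by (intro Bochner_Integration.integral_sum[symmetric] integrable_mult_right integrable_X_power)
    also have "\<dots> = (\<integral>x. r ^ n * (1 / r * X 0 x + t / r * X j x) ^ n \<partial>\<mu>)"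
    proof (intro Bochner_Integration.integral_cong refl)
      fix x
      have "(\<Sum>i\<le>n. real (n choose i) * t ^ i * (X 0 x ^ (n - i) * X j x ^ i)) = (t * X j x + X 0 x) ^ n"
        unfolding binomial_ring by (intro sum.cong) (simp_all add: power_mult_distrib)
      also have "t * X j x + X 0 x = r * (1 / r * X 0 x + t / r * X j x)"
        using r by (simp add: field_simps)
      finally show "(\<Sum>i\<le>n. real (n choose i) * t ^ i * (X 0 x ^ (n - i) * X j x ^ i))
          = r ^ n * (1 / r * X 0 x + t / r * X j x) ^ n"
        by (simp only: power_mult_distrib)
    qed
    also have "\<dots> = r ^ n * (\<integral>x. (1 / r * X 0 x + t / r * X j x) ^ n \<partial>\<mu>)"
      by simp
    also have "(\<integral>x. (1 / r * X 0 x + t / r * X j x) ^ n \<partial>\<mu>) = m n"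
      unfolding m_def
    proof (rule integral_rotate[OF _ _ j])
      show "(1 / r)\<^sup>2 + (t / r)\<^sup>2 = 1"
        unfolding power_divide r(2) using add_pos_nonneg[of 1 "t\<^sup>2"] by (simp flip: add_divide_distrib)
    qed measurable
    also have "r ^ n = (1 + t\<^sup>2) ^ Suc k"
      unfolding n_def power_mult r(2) ..
    finally show ?thesis by simp
  qed
  from coeff_two_power_one_plus_square[OF this] show ?thesis
    by (simp add: n_def)
qed

text \<open>The squares of the other three coordinates add up to \<open>1 - (X 0 x)\<^sup>2\<close>,
  and each contributes the same mixed moment, whence the factor 3. Odd moments vanish.\<close>

lemma moment_rec: "real (Suc n) * (m n - m (n + 2)) = 3 * m (n + 2)"
proof (cases "even n")
  case False
  thus ?thesis by (simp add: m_odd)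
next
  case True
  then obtain k where n: "n = 2 * k" by (auto elim: evenE)
  \<comment> \<open>With \<open>n = 2 * k\<close>, the factor \<open>Suc k\<close> then occurs on
    both sides of \<open>mixed_moment\<close> and cancels.\<close>
  have choose: "real (2 * Suc k choose 2) = real (Suc k) * real (Suc n)"
    using binomial_gbinomial[of "2 * Suc k" 2, where 'a=real]
    by (simp add: n numeral_2_eq_2 gbinomial_prod_rev field_simps)
  have mix: "real (Suc n) * (\<integral>x. X 0 x ^ n * X j x ^ 2 \<partial>\<mu>) = m (n + 2)" if "j \<in> {1, 2, 3}" for j
    using mixed_moment[OF that, of k] unfolding choose by (simp add: n)
  have "m n - m (n + 2) = (\<integral>x. X 0 x ^ n - X 0 x ^ (n + 2) \<partial>\<mu>)"
    unfolding m_def by (intro Bochner_Integration.integral_diff[symmetric] integrable_X_power_single)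
  also have "\<dots> = (\<integral>x. X 0 x ^ n * X 1 x ^ 2 + X 0 x ^ n * X 2 x ^ 2 + X 0 x ^ n * X 3 x ^ 2 \<partial>\<mu>)"
  proof (intro Bochner_Integration.integral_cong refl)
    fix x assume "x \<in> space \<mu>"
    hence "(X 1 x)\<^sup>2 + (X 2 x)\<^sup>2 + (X 3 x)\<^sup>2 = 1 - (X 0 x)\<^sup>2"
      using sum_X_squares[of x] by (simp add: space_haar)
    hence "X 0 x ^ n * ((X 1 x)\<^sup>2 + (X 2 x)\<^sup>2 + (X 3 x)\<^sup>2) = X 0 x ^ n * (1 - (X 0 x)\<^sup>2)"
      by simp
    thus "X 0 x ^ n - X 0 x ^ (n + 2)
        = X 0 x ^ n * X 1 x ^ 2 + X 0 x ^ n * X 2 x ^ 2 + X 0 x ^ n * X 3 x ^ 2"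
      by (simp add: algebra_simps power_add power2_eq_square)
  qed
  also have "\<dots> = (\<integral>x. X 0 x ^ n * X 1 x ^ 2 \<partial>\<mu>) + (\<integral>x. X 0 x ^ n * X 2 x ^ 2 \<partial>\<mu>)
      + (\<integral>x. X 0 x ^ n * X 3 x ^ 2 \<partial>\<mu>)"
    by (simp add: integrable_X_power)
  finally show ?thesis
    using mix[of 1] mix[of 2] mix[of 3] by (simp add: algebra_simps)
qed

section \<open>The mean-zero operator and orthonormality of the Chebyshev polynomials\<close>

lemma integrable_poly_X: "integrable \<mu> (\<lambda>x. poly P (X 0 x))"
proof -
  have "integrable \<mu> (\<lambda>x. \<Sum>i\<le>degree P. coeff P i * X 0 x ^ i)"
    by (intro Bochner_Integration.integrable_sum integrable_mult_right integrable_X_power_single)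
  thus ?thesis by (simp add: poly_altdef)
qed

text \<open>The operator is the Laplacian of the 3-sphere on functions of one coordinate. By
  linearity monomials suffice, and from degree 2 on the claim for them is
  \<open>moment_rec\<close>.\<close>

lemma expectation_radial_laplacian:
  "(\<integral>x. poly ([:1, 0, -1:] * pderiv (pderiv P) - [:0, 3:] * pderiv P) (X 0 x) \<partial>\<mu>) = 0"
proof -
  define L :: "real poly \<Rightarrow> real poly" where "L P = [:1, 0, -1:] * pderiv (pderiv P) - [:0, 3:] * pderiv P" for P
  define \<Phi> where "\<Phi> P = (\<integral>x. poly (L P) (X 0 x) \<partial>\<mu>)" for P
  have monom: "\<Phi> (monom c k) = 0" for c k
  proof -
    consider "k = 0" | "k = 1" | n where "k = n + 2"
      by (metis One_nat_def add_2_eq_Suc' not0_implies_Suc)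
    thus ?thesis
    proof cases
      case 1
      thus ?thesis by (simp add: \<Phi>_def L_def pderiv_monom)
    next
      case 2
      thus ?thesis using m_odd[of 1] by (simp add: \<Phi>_def L_def pderiv_monom m_def poly_monom)
    next
      case (3 n)
      have "poly (L (monom c k)) y = c * real (n + 2) * (real (n + 1) * y ^ n - real (n + 4) * y ^ (n + 2))" for y
        unfolding L_def 3 by (simp add: pderiv_monom poly_monom algebra_simps power_add power2_eq_square)
      hence "\<Phi> (monom c k) = (\<integral>x. c * real (n + 2) * (real (n + 1) * (X 0 x ^ n)
            - real (n + 4) * (X 0 x ^ (n + 2))) \<partial>\<mu>)"
        unfolding \<Phi>_def by simp
      also have "\<dots> = c * real (n + 2) * (real (n + 1) * (\<integral>x. X 0 x ^ n \<partial>\<mu>)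
            - real (n + 4) * (\<integral>x. X 0 x ^ (n + 2) \<partial>\<mu>))"
        by (simp only: integral_mult_right_zero Bochner_Integration.integral_diff
            integrable_mult_right integrable_X_power_single)
      also have "\<dots> = c * real (n + 2) * (real (n + 1) * m n - real (n + 4) * m (n + 2))"
        by (simp add: m_def)
      also have "real (n + 1) * m n - real (n + 4) * m (n + 2) = 0"
        using moment_rec[of n] by (simp add: algebra_simps)
      finally show ?thesis by simp
    qed
  qed
  have add: "\<Phi> (P + Q) = \<Phi> P + \<Phi> Q" for P Q
  proof -
    have "L (P + Q) = L P + L Q" unfolding L_def pderiv_add by (simp add: algebra_simps smult_add_right)
    thus ?thesis unfolding \<Phi>_def poly_add by (simp add: integrable_poly_X)
  qed
  have "\<Phi> (\<Sum>i\<in>A. monom (coeff P i) i) = 0" if "finite A" for A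
    using that by (induction A) (use monom[of 0 0] in \<open>simp_all add: add monom\<close>)
  from this[of "{..degree P}"] show ?thesis
    by (simp add: poly_as_sum_of_monoms \<Phi>_def L_def)
qed

text \<open>The operator has mean-zero image and acts here as the scalar
  \<open>- (n * (n + 2))\<close>, nonzero for positive \<open>n\<close>.\<close>

lemma expectation_chebyshev_U:
  "(\<integral>x. poly (chebyshev_U n) (X 0 x) \<partial>\<mu>) = (if n = 0 then 1 else 0)"
proof (cases "n = 0")
  case True
  thus ?thesis by (simp add: prob_space)
next
  case False
  have "poly ([:1, 0, -1:] * pderiv (pderiv (chebyshev_U n)) - [:0, 3:] * pderiv (chebyshev_U n)) y
      = - (real n * real (n + 2)) * poly (chebyshev_U n) y" for y
    using chebyshev_U_ode[of y n] by (simp add: algebra_simps power2_eq_square)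
  hence "- (real n * real (n + 2)) * (\<integral>x. poly (chebyshev_U n) (X 0 x) \<partial>\<mu>) = 0"
    using expectation_radial_laplacian[of "chebyshev_U n"] by simp
  thus ?thesis using False by simp
qed

lemma chebyshev_U_orthonormal:
  "(\<integral>x. poly (chebyshev_U i) (X 0 x) * poly (chebyshev_U j) (X 0 x) \<partial>\<mu>) = (if i = j then 1 else 0)"
proof -
  \<comment> \<open>Multiplication by \<open>2 x\<close> is symmetric for \<open>B\<close>, so the three-term recurrence determines \<open>B\<close> from \<open>B 0 j\<close>.\<close>
  define B where "B i j = (\<integral>x. poly (chebyshev_U i * chebyshev_U j) (X 0 x) \<partial>\<mu>)" for i j
  have B_eq: "B i j = (if i = j then 1 else 0)" for i j
  proof (induction i arbitrary: j rule: chebyshev_U.induct)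
    case (1 j)
    show ?case using expectation_chebyshev_U[of j] by (simp add: B_def)
  next
    case (2 j)
    show ?case
    proof (cases j)
      case 0
      thus ?thesis using expectation_chebyshev_U[of "Suc 0"] by (simp add: B_def)
    next
      case (Suc k)
      have "chebyshev_U (Suc 0) * chebyshev_U (Suc k) = chebyshev_U (Suc (Suc k)) + chebyshev_U k"
        by simp
      hence "B (Suc 0) (Suc k) = (\<integral>x. poly (chebyshev_U (Suc (Suc k))) (X 0 x) \<partial>\<mu>) + (\<integral>x. poly (chebyshev_U k) (X 0 x) \<partial>\<mu>)"
        unfolding B_def poly_add by (simp only: poly_add integrable_poly_X Bochner_Integration.integral_add)
      thus ?thesis using Suc by (simp only: expectation_chebyshev_U) auto
    qed
  next
    case (3 i j)
    show ?case
    proof (cases j)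
      case 0
      thus ?thesis using expectation_chebyshev_U[of "Suc (Suc i)"] by (simp add: B_def del: chebyshev_U.simps(3))
    next
      case (Suc k)
      have "chebyshev_U (Suc (Suc i)) * chebyshev_U (Suc k) + chebyshev_U i * chebyshev_U (Suc k)
         = chebyshev_U (Suc i) * chebyshev_U (Suc (Suc k)) + chebyshev_U (Suc i) * chebyshev_U k"
        by (simp add: algebra_simps)
      hence "(\<integral>x. poly (chebyshev_U (Suc (Suc i)) * chebyshev_U (Suc k) + chebyshev_U i * chebyshev_U (Suc k)) (X 0 x) \<partial>\<mu>)
        = (\<integral>x. poly (chebyshev_U (Suc i) * chebyshev_U (Suc (Suc k)) + chebyshev_U (Suc i) * chebyshev_U k) (X 0 x) \<partial>\<mu>)"
        by (rule arg_cong)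
      hence "B (Suc (Suc i)) (Suc k) + B i (Suc k) = B (Suc i) (Suc (Suc k)) + B (Suc i) k"
        unfolding B_def by (simp only: poly_add integrable_poly_X Bochner_Integration.integral_add)
      thus ?thesis using 3 Suc by auto
    qed
  qed
  thus ?thesis using B_eq[of i j] by (simp add: B_def)
qed

end

section \<open>Inequalities for finite sums and Fatou's lemma\<close>

text \<open>Jensen's inequality for the power \<open>p\<close> with weights \<open>w i / W\<close>
  at the points \<open>x i / w i\<close>, multiplied by \<open>W powr p\<close>.\<close>

lemma sum_powr_weighted_le:
  fixes x w :: "'i \<Rightarrow> real"
  assumes S: "finite S" and p: "1 \<le> p" and x: "\<And>i. i \<in> S \<Longrightarrow> 0 \<le> x i" and w: "\<And>i. i \<in> S \<Longrightarrow> 0 < w i"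
  shows "(\<Sum>i\<in>S. x i) powr p \<le> (\<Sum>i\<in>S. w i) powr (p - 1) * (\<Sum>i\<in>S. w i powr (1 - p) * x i powr p)"
proof -
  \<comment> \<open>Vanishing terms are set aside so that Jensen is applied at positive points;
    restoring them only enlarges the right-hand side.\<close>
  define S' where "S' = {i\<in>S. x i > 0}"
  have S': "finite S'" "S' \<subseteq> S" "\<And>i. i \<in> S' \<Longrightarrow> 0 < x i" "\<And>i. i \<in> S' \<Longrightarrow> 0 < w i"
    using S w by (auto simp: S'_def)
  have sum_x: "(\<Sum>i\<in>S. x i) = (\<Sum>i\<in>S'. x i)"
    using S x by (intro sum.mono_neutral_right) (auto simp: S'_def less_le)
  show ?thesis
  proof (cases "S' = {}")
    case True
    thus ?thesis unfolding sum_x by (auto intro!: mult_nonneg_nonneg sum_nonneg)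
  next
    case False
    define W where "W = (\<Sum>i\<in>S'. w i)"
    have W: "W > 0" unfolding W_def using S' False by (intro sum_pos) auto
    have "(\<Sum>i\<in>S'. (w i / W) *\<^sub>R (x i / w i)) powr p \<le> (\<Sum>i\<in>S'. (w i / W) * (x i / w i) powr p)"
    proof (rule convex_on_sum[OF S'(1) False powr_convex[OF p]])
      show "(\<Sum>i\<in>S'. w i / W) = 1"
        unfolding W_def sum_divide_distrib[symmetric] using W W_def by simp
    qed (use S' W in \<open>auto intro: less_imp_le\<close>)
    moreover have "(\<Sum>i\<in>S'. (w i / W) *\<^sub>R (x i / w i)) = (\<Sum>i\<in>S'. x i) / W"
      unfolding sum_divide_distrib using S'(4) by (intro sum.cong) (force simp: field_simps)+
    ultimately have "((\<Sum>i\<in>S'. x i) / W) powr p \<le> (\<Sum>i\<in>S'. (w i / W) * (x i / w i) powr p)"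
      by simp
    hence "W powr p * ((\<Sum>i\<in>S'. x i) / W) powr p \<le> W powr p * (\<Sum>i\<in>S'. (w i / W) * (x i / w i) powr p)"
      by (intro mult_left_mono) auto
    moreover have "W powr p * ((\<Sum>i\<in>S'. x i) / W) powr p = (\<Sum>i\<in>S'. x i) powr p"
      using W S'(3) by (subst powr_mult[symmetric]) (auto intro: sum_nonneg less_imp_le)
    moreover have "W powr p * (\<Sum>i\<in>S'. (w i / W) * (x i / w i) powr p)
        = W powr (p - 1) * (\<Sum>i\<in>S'. w i powr (1 - p) * x i powr p)"
      unfolding sum_distrib_left
    proof (intro sum.cong refl)
      fix i assume i: "i \<in> S'"
      show "W powr p * (w i / W * (x i / w i) powr p) = W powr (p - 1) * (w i powr (1 - p) * x i powr p)"
        using W S'(3,4)[OF i] by (simp add: powr_divide powr_diff)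
    qed
    ultimately have "(\<Sum>i\<in>S'. x i) powr p \<le> W powr (p - 1) * (\<Sum>i\<in>S'. w i powr (1 - p) * x i powr p)"
      by simp
    also have "\<dots> \<le> (\<Sum>i\<in>S. w i) powr (p - 1) * (\<Sum>i\<in>S. w i powr (1 - p) * x i powr p)"
      using S S' W w p unfolding W_def
      by (intro mult_mono powr_mono2 sum_mono2 sum_nonneg mult_nonneg_nonneg) (auto intro: less_imp_le)
    finally show ?thesis unfolding sum_x .
  qed
qed

lemma sum_powr_le_card:
  fixes x :: "'i \<Rightarrow> real"
  assumes "finite S" "1 \<le> p" "\<And>i. i \<in> S \<Longrightarrow> 0 \<le> x i" "real (card S) \<le> N"
  shows "(\<Sum>i\<in>S. x i) powr p \<le> N powr (p - 1) * (\<Sum>i\<in>S. x i powr p)"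
proof -
  have "(\<Sum>i\<in>S. x i) powr p \<le> (real (card S)) powr (p - 1) * (\<Sum>i\<in>S. x i powr p)"
    using sum_powr_weighted_le[of S p x "\<lambda>_. 1"] assms by simp
  also have "\<dots> \<le> N powr (p - 1) * (\<Sum>i\<in>S. x i powr p)"
    using assms by (intro mult_right_mono powr_mono2 sum_nonneg) auto
  finally show ?thesis .
qed

text \<open>Each factor is compared with the sum \<open>T\<close> of p-th powers: the first enters
  with exponent \<open>(p - 2) / p\<close>, the second with \<open>2 / p\<close>. The exponents of
  \<open>T\<close> add up to 1, those of \<open>N\<close> to \<open>p - 2\<close>.\<close>

lemma l1_l2_lp_interpolation:
  fixes x :: "'i \<Rightarrow> real"
  assumes S: "finite S" and p: "2 \<le> p" and x: "\<And>i. i \<in> S \<Longrightarrow> 0 \<le> x i" and N: "real (card S) \<le> N"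
  shows "(\<Sum>i\<in>S. x i) powr (p - 2) * (\<Sum>i\<in>S. (x i)\<^sup>2) \<le> N powr (p - 2) * (\<Sum>i\<in>S. x i powr p)"
proof -
  define S1 S2 T where "S1 = (\<Sum>i\<in>S. x i)" and "S2 = (\<Sum>i\<in>S. (x i)\<^sup>2)" and "T = (\<Sum>i\<in>S. x i powr p)"
  have nn: "0 \<le> S1" "0 \<le> S2" "0 \<le> T" "0 \<le> N"
    using x N by (auto simp: S1_def S2_def T_def intro!: sum_nonneg)
  have "S1 powr p \<le> N powr (p - 1) * T"
    unfolding S1_def T_def using assms by (intro sum_powr_le_card) auto
  hence 1: "(S1 powr p) powr ((p - 2) / p) \<le> (N powr (p - 1) * T) powr ((p - 2) / p)"
    using p by (intro powr_mono2) auto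
  have "S2 powr (p / 2) \<le> N powr (p / 2 - 1) * (\<Sum>i\<in>S. (x i)\<^sup>2 powr (p / 2))"
    unfolding S2_def using assms by (intro sum_powr_le_card) auto
  also have "(\<Sum>i\<in>S. (x i)\<^sup>2 powr (p / 2)) = T"
    unfolding T_def
  proof (intro sum.cong refl)
    fix i assume "i \<in> S"
    thus "(x i)\<^sup>2 powr (p / 2) = x i powr p"
      using x[of i] by (cases "x i = 0") (simp_all add: powr_powr flip: powr_numeral)
  qed
  finally have 2: "(S2 powr (p / 2)) powr (2 / p) \<le> (N powr (p / 2 - 1) * T) powr (2 / p)"
    using p by (intro powr_mono2) auto
  have "S1 powr (p - 2) * S2 = (S1 powr p) powr ((p - 2) / p) * (S2 powr (p / 2)) powr (2 / p)"
    using p nn by (simp add: powr_powr)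
  also have "\<dots> \<le> (N powr (p - 1) * T) powr ((p - 2) / p) * (N powr (p / 2 - 1) * T) powr (2 / p)"
    by (intro mult_mono 1 2) auto
  also have "\<dots> = (N powr ((p - 1) * ((p - 2) / p)) * N powr ((p / 2 - 1) * (2 / p))) * (T powr ((p - 2) / p) * T powr (2 / p))"
    using nn by (simp add: powr_mult powr_powr)
  also have "T powr ((p - 2) / p) * T powr (2 / p) = T"
    using p nn by (simp add: diff_divide_distrib flip: powr_add)
  also have "N powr ((p - 1) * ((p - 2) / p)) * N powr ((p / 2 - 1) * (2 / p)) = N powr (p - 2)"
  proof -
    have "(p - 1) * ((p - 2) / p) + (p / 2 - 1) * (2 / p) = p - 2"
      using p by (simp add: field_simps)
    thus ?thesis by (simp flip: powr_add)
  qed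
  finally show ?thesis by (simp add: S1_def S2_def T_def)
qed

text \<open>Fatou's lemma; almost everywhere the limit inferior is the limit.\<close>

lemma nn_integral_le_of_AE_tendsto:
  fixes u :: "nat \<Rightarrow> 'a \<Rightarrow> real"
  assumes [measurable]: "\<And>i. u i \<in> borel_measurable M" "v \<in> borel_measurable M"
    and lim: "AE x in M. (\<lambda>i. u i x) \<longlonglongrightarrow> v x"
    and le: "eventually (\<lambda>i. (\<integral>\<^sup>+x. ennreal (u i x) \<partial>M) \<le> B) sequentially"
  shows "(\<integral>\<^sup>+x. ennreal (v x) \<partial>M) \<le> B"
proof -
  have "(\<integral>\<^sup>+x. ennreal (v x) \<partial>M) = (\<integral>\<^sup>+x. liminf (\<lambda>i. ennreal (u i x)) \<partial>M)"
  proof (rule nn_integral_cong_AE)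
    show "AE x in M. ennreal (v x) = liminf (\<lambda>i. ennreal (u i x))"
      using lim by eventually_elim (intro lim_imp_Liminf[symmetric] tendsto_ennrealI; simp)
  qed
  also have "\<dots> \<le> liminf (\<lambda>i. \<integral>\<^sup>+x. ennreal (u i x) \<partial>M)"
    by (intro nn_integral_liminf) measurable
  also have "\<dots> \<le> B"
  proof -
    have "liminf (\<lambda>i. \<integral>\<^sup>+x. ennreal (u i x) \<partial>M) \<le> liminf (\<lambda>i. B)"
      by (intro Liminf_mono le)
    thus ?thesis by (simp add: Liminf_const)
  qed
  finally show ?thesis .
qed

section \<open>Bounded orthonormal systems\<close>

text \<open>The analysis uses the characters only through these properties. \<open>Suc n\<close> is
  the dimension of the representation, which bounds its trace; \<open>e_total\<close> says that an
  integrable function is determined by its coefficients.\<close>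

locale bounded_orthonormal_system = prob_space M for M :: "'a measure" +
  fixes e :: "nat \<Rightarrow> 'a \<Rightarrow> real"
  assumes measurable_e [measurable]: "\<And>n. e n \<in> borel_measurable M"
    and e_bound: "\<And>n x. x \<in> space M \<Longrightarrow> \<bar>e n x\<bar> \<le> real (Suc n)"
    and e_orthonormal: "\<And>i j. (\<integral>x. e i x * e j x \<partial>M) = (if i = j then 1 else 0)"
    and e_total: "\<And>h :: 'a \<Rightarrow> complex. integrable M h \<Longrightarrow>
      (\<And>n. (\<integral>x. h x * complex_of_real (e n x) \<partial>M) = 0) \<Longrightarrow> AE x in M. h x = 0"
begin

definition coef :: "('a \<Rightarrow> complex) \<Rightarrow> nat \<Rightarrow> complex" where
  "coef f n = (\<integral>x. f x * complex_of_real (e n x) \<partial>M)"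

definition psum :: "(nat \<Rightarrow> complex) \<Rightarrow> nat set \<Rightarrow> 'a \<Rightarrow> complex" where
  "psum a A x = (\<Sum>n\<in>A. a n * complex_of_real (e n x))"

lemma measurable_psum [measurable]: "psum a A \<in> borel_measurable M"
  unfolding psum_def by measurable

lemma psum_bound:
  assumes "x \<in> space M" "\<And>n. n \<in> A \<Longrightarrow> real (Suc n) \<le> N"
  shows "cmod (psum a A x) \<le> N * (\<Sum>n\<in>A. cmod (a n))"
proof -
  have "cmod (psum a A x) \<le> (\<Sum>n\<in>A. cmod (a n * complex_of_real (e n x)))"
    unfolding psum_def by (rule norm_sum)
  also have "\<dots> \<le> (\<Sum>n\<in>A. N * cmod (a n))"
  proof (intro sum_mono)
    fix n assume "n \<in> A"
    hence "\<bar>e n x\<bar> \<le> N" using e_bound[OF assms(1), of n] assms(2)[of n] by simp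
    hence "\<bar>e n x\<bar> * cmod (a n) \<le> N * cmod (a n)" by (rule mult_right_mono) simp
    thus "cmod (a n * complex_of_real (e n x)) \<le> N * cmod (a n)"
      by (simp add: norm_mult mult.commute)
  qed
  finally show ?thesis by (simp add: sum_distrib_left)
qed

lemma integrable_bounded:
  fixes h :: "'a \<Rightarrow> 'b::{banach, second_countable_topology}"
  assumes "h \<in> borel_measurable M" "\<And>x. x \<in> space M \<Longrightarrow> norm (h x) \<le> B"
  shows "integrable M h"
  using assms by (intro integrable_const_bound[of _ B] AE_I2)

lemma psum_bounded:
  assumes "finite A"
  obtains B where "B \<ge> 0" "\<And>x. x \<in> space M \<Longrightarrow> cmod (psum a A x) \<le> B"
proof (rule that)
  show "0 \<le> (\<Sum>n\<in>A. real (Suc n)) * (\<Sum>n\<in>A. cmod (a n))"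
    by (intro mult_nonneg_nonneg sum_nonneg) auto
  show "cmod (psum a A x) \<le> (\<Sum>n\<in>A. real (Suc n)) * (\<Sum>n\<in>A. cmod (a n))" if "x \<in> space M" for x
    using that assms by (intro psum_bound member_le_sum[where f = "\<lambda>n. real (Suc n)"]) auto
qed

lemma integrable_psum: "finite A \<Longrightarrow> integrable M (psum a A)"
  by (metis psum_bounded integrable_bounded measurable_psum)

lemma integrable_psum_powr:
  assumes "finite A" "0 \<le> p"
  shows "integrable M (\<lambda>x. cmod (psum a A x) powr p)"
proof -
  obtain B where B: "B \<ge> 0" "\<And>x. x \<in> space M \<Longrightarrow> cmod (psum a A x) \<le> B"
    using psum_bounded[OF assms(1)] by metis
  show ?thesis
    by (rule integrable_bounded[of _ "B powr p"]) (use B assms in \<open>auto intro!: powr_mono2\<close>)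
qed

lemma integrable_mult_e:
  fixes h :: "'a \<Rightarrow> complex"
  assumes h: "integrable M h"
  shows "integrable M (\<lambda>x. h x * complex_of_real (e n x))"
proof (rule Bochner_Integration.integrable_bound)
  show "integrable M (\<lambda>x. real (Suc n) * norm (h x))"
    using h by (intro integrable_mult_right integrable_norm)
  show "AE x in M. norm (h x * complex_of_real (e n x)) \<le> norm (real (Suc n) * norm (h x))"
    using e_bound[of _ n] by (intro AE_I2) (simp add: norm_mult mult.commute[of "1 + real n"] mult_left_mono)
qed (use h in measurable)

lemma integrable_e_mult_e: "integrable M (\<lambda>x. e i x * e j x)"
  by (rule integrable_bounded[of _ "real (Suc i) * real (Suc j)"])
    (auto simp: abs_mult simp del: of_nat_Suc intro!: mult_mono e_bound)

section \<open>Parseval's identity and dyadic blocks\<close>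

lemma coef_psum:
  assumes "finite A"
  shows "coef (psum a A) n = (if n \<in> A then a n else 0)"
proof -
  have "coef (psum a A) n = (\<integral>x. (\<Sum>i\<in>A. a i * complex_of_real (e i x * e n x)) \<partial>M)"
    unfolding coef_def psum_def by (simp add: sum_distrib_right mult.assoc)
  also have "\<dots> = (\<Sum>i\<in>A. \<integral>x. a i * complex_of_real (e i x * e n x) \<partial>M)"
    by (intro Bochner_Integration.integral_sum integrable_mult_right integrable_of_real integrable_e_mult_e)
  also have "\<dots> = (\<Sum>i\<in>A. a i * complex_of_real (\<integral>x. e i x * e n x \<partial>M))"
    by (simp only: integral_mult_right_zero integral_complex_of_real)
  also have "\<dots> = (\<Sum>i\<in>A. if i = n then a i else 0)"
    by (intro sum.cong) (auto simp: e_orthonormal)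
  finally show ?thesis using assms by (simp add: sum.delta')
qed

lemma parseval:
  assumes A: "finite A"
  shows "(\<integral>x. (cmod (psum a A x))\<^sup>2 \<partial>M) = (\<Sum>n\<in>A. (cmod (a n))\<^sup>2)"
proof -
  have "complex_of_real (\<integral>x. (cmod (psum a A x))\<^sup>2 \<partial>M) = (\<integral>x. psum a A x * cnj (psum a A x) \<partial>M)"
    by (simp only: complex_norm_square flip: integral_complex_of_real)
  also have "\<dots> = (\<integral>x. (\<Sum>n\<in>A. cnj (a n) * (psum a A x * complex_of_real (e n x))) \<partial>M)"
    by (intro Bochner_Integration.integral_cong refl) (simp add: psum_def sum_distrib_left mult_ac)
  also have "\<dots> = (\<Sum>n\<in>A. \<integral>x. cnj (a n) * (psum a A x * complex_of_real (e n x)) \<partial>M)"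
    by (intro Bochner_Integration.integral_sum integrable_mult_right integrable_mult_e integrable_psum A)
  also have "\<dots> = (\<Sum>n\<in>A. cnj (a n) * coef (psum a A) n)"
    by (simp only: integral_mult_right_zero coef_def)
  also have "\<dots> = (\<Sum>n\<in>A. complex_of_real ((cmod (a n))\<^sup>2))"
    by (intro sum.cong refl) (simp only: coef_psum[OF A] complex_norm_square mult.commute if_True)
  finally show ?thesis by (simp only: of_real_eq_iff flip: of_real_sum)
qed

text \<open>One factor \<open>N powr (p - 2)\<close> comes from the sup norms of the
  \<open>e n\<close>, the other from passing to p-th powers in
  \<open>l1_l2_lp_interpolation\<close>.\<close>

lemma block_bound:
  assumes A: "finite A" "real (card A) \<le> N" "\<And>n. n \<in> A \<Longrightarrow> real (Suc n) \<le> 2 * N" and p: "2 \<le> p"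
  shows "(\<integral>x. cmod (psum a A x) powr p \<partial>M)
    \<le> 2 powr (p - 2) * N powr (2 * (p - 2)) * (\<Sum>n\<in>A. cmod (a n) powr p)"
proof -
  define S1 where "S1 = (\<Sum>n\<in>A. cmod (a n))"
  have nn: "0 \<le> S1" "0 \<le> N" using A(2) by (auto simp: S1_def intro: sum_nonneg)
  have "(\<integral>x. cmod (psum a A x) powr p \<partial>M) \<le> (\<integral>x. (2 * N * S1) powr (p - 2) * (cmod (psum a A x))\<^sup>2 \<partial>M)"
  proof (rule integral_mono)
    show "integrable M (\<lambda>x. cmod (psum a A x) powr p)"
      using A p by (intro integrable_psum_powr) auto
    show "integrable M (\<lambda>x. (2 * N * S1) powr (p - 2) * (cmod (psum a A x))\<^sup>2)"
      using integrable_psum_powr[OF A(1), of 2 a] by (intro integrable_mult_right) simp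
    fix x assume "x \<in> space M"
    hence le: "cmod (psum a A x) \<le> 2 * N * S1"
      unfolding S1_def using A(3) by (rule psum_bound)
    \<comment> \<open>Zeros of the sum are covered even for \<open>p = 2\<close>, since
      \<open>0 powr 0 = 0\<close>.\<close>
    have "cmod (psum a A x) powr p = cmod (psum a A x) powr (p - 2) * cmod (psum a A x) powr 2"
      by (simp only: powr_add[symmetric] diff_add_cancel)
    also have "\<dots> \<le> (2 * N * S1) powr (p - 2) * cmod (psum a A x) powr 2"
      using p le by (intro mult_right_mono powr_mono2) auto
    finally show "cmod (psum a A x) powr p \<le> (2 * N * S1) powr (p - 2) * (cmod (psum a A x))\<^sup>2"
      by simp
  qed
  also have "\<dots> = (2 * N) powr (p - 2) * (S1 powr (p - 2) * (\<Sum>n\<in>A. (cmod (a n))\<^sup>2))"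
    using nn by (simp add: parseval[OF A(1)] powr_mult)
  also have "\<dots> \<le> (2 * N) powr (p - 2) * (N powr (p - 2) * (\<Sum>n\<in>A. cmod (a n) powr p))"
    unfolding S1_def using A p by (intro mult_left_mono l1_l2_lp_interpolation) auto
  also have "\<dots> = 2 powr (p - 2) * N powr (2 * (p - 2)) * (\<Sum>n\<in>A. cmod (a n) powr p)"
    using nn by (simp add: powr_mult algebra_simps flip: powr_add)
  finally show ?thesis .
qed

text \<open>The shift by one lets \<open>Suc n\<close>, the base of both the sup bound and the
  weight, run from \<open>2 ^ k\<close> to \<open>2 ^ Suc k - 1\<close>.\<close>

definition block :: "nat \<Rightarrow> nat set" where
  "block k = {2 ^ k - 1..<2 ^ Suc k - 1}"

lemma finite_block [simp]: "finite (block k)"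
  by (simp add: block_def)

lemma card_block: "card (block k) = 2 ^ k"
  by (simp add: block_def)

lemma sum_blocks: "(\<Sum>k<K. sum g (block k)) = sum g {..<2 ^ K - 1 :: nat}"
proof (induction K)
  case (Suc K)
  have le: "(2::nat) ^ K - 1 \<le> 2 ^ Suc K - 1" by (intro diff_le_mono power_increasing) auto
  have "{..<2 ^ Suc K - 1} = {..<2 ^ K - 1} \<union> block K"
    unfolding block_def using le by auto
  moreover have "{..<2 ^ K - 1} \<inter> block K = {}" by (auto simp: block_def)
  ultimately show ?case by (simp add: Suc sum.union_disjoint)
qed simp

lemma block_ge: "n \<in> block k \<Longrightarrow> 2 ^ k \<le> real (Suc n)"
proof -
  assume "n \<in> block k"
  hence "2 ^ k \<le> Suc n" by (auto simp: block_def)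
  hence "real (2 ^ k) \<le> real (Suc n)" by (rule of_nat_mono)
  thus ?thesis by simp
qed

lemma block_le: "n \<in> block k \<Longrightarrow> real (Suc n) \<le> 2 * 2 ^ k"
proof -
  assume "n \<in> block k"
  hence "Suc n \<le> 2 * 2 ^ k" by (auto simp: block_def)
  hence "real (Suc n) \<le> real (2 * 2 ^ k)" by (rule of_nat_mono)
  thus ?thesis by simp
qed

text \<open>The cut-off \<open>2 ^ K - 1\<close> keeps blocks whole. That \<open>C\<close> is
  uniform in \<open>K\<close> lets the bound survive the passage to the limit.\<close>

lemma psum_powr_bound:
  assumes p: "2 \<le> p"
  obtains C where "C > 0"
    "\<And>a K. (\<integral>x. cmod (psum a {..<2 ^ K - 1} x) powr p \<partial>M)
        \<le> C * (\<Sum>n<2 ^ K - 1. real (Suc n) powr (4 * p - 8) * cmod (a n) powr p)"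
proof (cases "p = 2")
  \<comment> \<open>Here the weights are 1 and Parseval is an equality, whereas the ratio
    \<open>r\<close> used below would be 1.\<close>
  case True
  show thesis
    by (rule that[of 1]) (simp_all add: True parseval)
next
  case False
  with p have p: "2 < p" by simp
  \<comment> \<open>With weight \<open>r ^ k\<close> on the \<open>k\<close>-th block, Jensen's inequality costs exactly the spare factor
    \<open>(2 ^ k) powr (2 * (p - 2))\<close>.\<close>
  define r where "r = 2 powr (- (2 * (p - 2) / (p - 1)))"
  have r: "0 < r" "r < 1"
    using p by (auto simp: r_def intro!: powr_less_one)
  \<comment> \<open>The sum of the full geometric series, which bounds the total weight for every
    \<open>K\<close>.\<close>
  define W where "W = 1 / (1 - r)"
  have W: "W > 0" using r by (simp add: W_def)
  have rpow: "(r ^ k) powr (1 - p) = (2 ^ k) powr (2 * (p - 2))" for k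
  proof -
    have "- (2 * (p - 2) / (p - 1)) * (1 - p) = 2 * (p - 2)"
      using p by (simp add: field_simps)
    hence "(2::real) powr (real k * (- (2 * (p - 2) / (p - 1)) * (1 - p))) = 2 powr (real k * (2 * (p - 2)))"
      by (simp only:)
    thus ?thesis
      by (simp add: r_def powr_powr mult_ac flip: powr_realpow)
  qed
  have bound: "(\<integral>x. cmod (psum a {..<2 ^ K - 1} x) powr p \<partial>M)
        \<le> W powr (p - 1) * 2 powr (p - 2) * (\<Sum>n<2 ^ K - 1. real (Suc n) powr (4 * p - 8) * cmod (a n) powr p)" for a K
  proof -
    have "(\<integral>x. cmod (psum a {..<2 ^ K - 1} x) powr p \<partial>M)
      \<le> (\<integral>x. W powr (p - 1) * (\<Sum>k<K. (2 ^ k) powr (2 * (p - 2)) * cmod (psum a (block k) x) powr p) \<partial>M)"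
    proof (rule integral_mono)
      show "integrable M (\<lambda>x. cmod (psum a {..<2 ^ K - 1} x) powr p)"
        using p by (intro integrable_psum_powr) auto
      show "integrable M (\<lambda>x. W powr (p - 1) * (\<Sum>k<K. (2 ^ k) powr (2 * (p - 2)) * cmod (psum a (block k) x) powr p))"
        using p by (intro integrable_mult_right Bochner_Integration.integrable_sum integrable_psum_powr) auto
      fix x
      have "psum a {..<2 ^ K - 1} x = (\<Sum>k<K. psum a (block k) x)"
        unfolding psum_def by (rule sum_blocks[symmetric])
      hence "cmod (psum a {..<2 ^ K - 1} x) powr p \<le> (\<Sum>k<K. cmod (psum a (block k) x)) powr p"
        using p by (intro powr_mono2) (auto intro: norm_sum)
      also have "\<dots> \<le> (\<Sum>k<K. r ^ k) powr (p - 1)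
          * (\<Sum>k<K. (r ^ k) powr (1 - p) * cmod (psum a (block k) x) powr p)"
        using p r by (intro sum_powr_weighted_le) auto
      also have "\<dots> \<le> W powr (p - 1) * (\<Sum>k<K. (r ^ k) powr (1 - p) * cmod (psum a (block k) x) powr p)"
      proof (intro mult_right_mono powr_mono2)
        show "(\<Sum>k<K. r ^ k) \<le> W"
          using r by (simp add: W_def sum_gp_strict divide_right_mono)
      qed (use p r in \<open>auto intro!: sum_nonneg\<close>)
      finally show "cmod (psum a {..<2 ^ K - 1} x) powr p
        \<le> W powr (p - 1) * (\<Sum>k<K. (2 ^ k) powr (2 * (p - 2)) * cmod (psum a (block k) x) powr p)"
        unfolding rpow .
    qed
    also have "\<dots> = W powr (p - 1) * (\<Sum>k<K. (2 ^ k) powr (2 * (p - 2)) * (\<integral>x. cmod (psum a (block k) x) powr p \<partial>M))"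
      using p by (simp add: integrable_psum_powr)
    also have "\<dots> \<le> W powr (p - 1) * (\<Sum>k<K. 2 powr (p - 2) *
        (\<Sum>n\<in>block k. real (Suc n) powr (4 * p - 8) * cmod (a n) powr p))"
    proof (intro mult_left_mono sum_mono)
      fix k assume "k \<in> {..<K}"
      have "(2 ^ k) powr (2 * (p - 2)) * (\<integral>x. cmod (psum a (block k) x) powr p \<partial>M)
        \<le> (2 ^ k) powr (2 * (p - 2)) * (2 powr (p - 2) * (2 ^ k) powr (2 * (p - 2)) * (\<Sum>n\<in>block k. cmod (a n) powr p))"
        using p block_le by (intro mult_left_mono block_bound) (auto simp: card_block)
      also have "\<dots> = 2 powr (p - 2) * (((2 ^ k) powr (2 * (p - 2)) * (2 ^ k) powr (2 * (p - 2))) * (\<Sum>n\<in>block k. cmod (a n) powr p))"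
        by (simp add: mult_ac)
      \<comment> \<open>One of the two equal powers is the price of Jensen, the other comes from
        \<open>block_bound\<close>; together they are at most the weight of every index in the
        block.\<close>
      also have "((2::real) ^ k) powr (2 * (p - 2)) * (2 ^ k) powr (2 * (p - 2)) = (2 ^ k) powr (4 * p - 8)"
        by (simp flip: powr_add)
      also have "2 powr (p - 2) * ((2 ^ k) powr (4 * p - 8) * (\<Sum>n\<in>block k. cmod (a n) powr p))
        \<le> 2 powr (p - 2) * (\<Sum>n\<in>block k. real (Suc n) powr (4 * p - 8) * cmod (a n) powr p)"
        unfolding sum_distrib_left using p block_ge
        by (intro sum_mono mult_left_mono mult_right_mono powr_mono2) auto
      finally show "(2 ^ k) powr (2 * (p - 2)) * (\<integral>x. cmod (psum a (block k) x) powr p \<partial>M)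
        \<le> 2 powr (p - 2) * (\<Sum>n\<in>block k. real (Suc n) powr (4 * p - 8) * cmod (a n) powr p)" .
    qed simp
    also have "\<dots> = W powr (p - 1) * 2 powr (p - 2) * (\<Sum>n<2 ^ K - 1. real (Suc n) powr (4 * p - 8) * cmod (a n) powr p)"
      by (simp add: sum_blocks mult.assoc flip: sum_distrib_left)
    finally show ?thesis .
  qed
  show thesis
    using W by (intro that[OF _ bound]) auto
qed

section \<open>Square summability and almost everywhere convergence of partial sums\<close>

lemma summable_coef_square:
  assumes p: "2 \<le> p" and summable: "summable (\<lambda>n. real (Suc n) powr (4 * p - 8) * cmod (a n) powr p)"
  shows "summable (\<lambda>n. (cmod (a n))\<^sup>2)"
proof (rule summable_comparison_test')
  \<comment> \<open>The first summand takes care of small coefficients, the second of large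
    ones.\<close>
  show "summable (\<lambda>n. 1 / real (Suc n) ^ 2 + real (Suc n) powr (4 * p - 8) * cmod (a n) powr p)"
  proof (intro summable_add summable)
    have "summable (\<lambda>n. inverse (real (Suc n) ^ 2))"
      using inverse_power_summable[of 2, where 'a = real] by (subst summable_Suc_iff) simp
    thus "summable (\<lambda>n. 1 / real (Suc n) ^ 2)" by (simp only: inverse_eq_divide)
  qed
  fix n :: nat
  define N where "N = real (Suc n)"
  have N: "N \<ge> 1" by (simp add: N_def)
  show "norm ((cmod (a n))\<^sup>2) \<le> 1 / real (Suc n) ^ 2 + real (Suc n) powr (4 * p - 8) * cmod (a n) powr p"
    unfolding N_def[symmetric]
  \<comment> \<open>Either \<open>N * |a n| \<le> 1\<close>, or \<open>(N * |a n|) powr (p - 2) \<ge> 1\<close>.\<close>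
  proof (cases "N * cmod (a n) \<le> 1")
    case True
    hence "(N * cmod (a n))\<^sup>2 \<le> 1" using N by (intro power_le_one) auto
    hence "(cmod (a n))\<^sup>2 \<le> 1 / N\<^sup>2" using N by (simp add: field_simps power_mult_distrib)
    thus "norm ((cmod (a n))\<^sup>2) \<le> 1 / N\<^sup>2 + N powr (4 * p - 8) * cmod (a n) powr p"
      by (simp add: add_increasing2)
  next
    case False
    hence pos: "cmod (a n) > 0" by auto
    have "1 \<le> (N * cmod (a n)) powr (p - 2)"
      using False p by (intro ge_one_powr_ge_zero) auto
    also have "\<dots> = N powr (p - 2) * cmod (a n) powr (p - 2)"
      using N by (simp add: powr_mult)
    also have "\<dots> \<le> N powr (4 * p - 8) * cmod (a n) powr (p - 2)"
      using N p by (intro mult_right_mono powr_mono) auto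
    finally have "1 * (cmod (a n))\<^sup>2 \<le> N powr (4 * p - 8) * cmod (a n) powr (p - 2) * (cmod (a n))\<^sup>2"
      by (intro mult_right_mono) auto
    also have "\<dots> = N powr (4 * p - 8) * (cmod (a n) powr (p - 2) * cmod (a n) powr 2)"
      using pos by simp
    also have "\<dots> = N powr (4 * p - 8) * cmod (a n) powr p"
      by (simp only: powr_add[symmetric] diff_add_cancel)
    finally show "norm ((cmod (a n))\<^sup>2) \<le> 1 / N\<^sup>2 + N powr (4 * p - 8) * cmod (a n) powr p"
      by (simp add: add_increasing)
  qed
qed

text \<open>Pointwise this is the inequality of arithmetic and geometric means; it serves in place
  of Cauchy-Schwarz.\<close>

lemma integral_norm_le_square:
  fixes h :: "'a \<Rightarrow> complex"
  assumes h: "integrable M h" and h2: "integrable M (\<lambda>x. (cmod (h x))\<^sup>2)" and "0 < \<epsilon>"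
  shows "(\<integral>x. cmod (h x) \<partial>M) \<le> \<epsilon> / 2 + (\<integral>x. (cmod (h x))\<^sup>2 \<partial>M) / (2 * \<epsilon>)"
proof -
  have "(\<integral>x. cmod (h x) \<partial>M) \<le> (\<integral>x. \<epsilon> / 2 + (cmod (h x))\<^sup>2 / (2 * \<epsilon>) \<partial>M)"
  proof (rule integral_mono)
    fix x
    have "0 \<le> (cmod (h x) - \<epsilon>)\<^sup>2" by simp
    thus "cmod (h x) \<le> \<epsilon> / 2 + (cmod (h x))\<^sup>2 / (2 * \<epsilon>)"
      using \<open>0 < \<epsilon>\<close> by (simp add: field_simps power2_eq_square)
  qed (use h h2 in auto)
  also have "\<dots> = \<epsilon> / 2 + (\<integral>x. (cmod (h x))\<^sup>2 \<partial>M) / (2 * \<epsilon>)"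
    using h2 by (simp add: prob_space)
  finally show ?thesis .
qed

lemma psum_L1_Cauchy:
  assumes summable: "summable (\<lambda>n. (cmod (a n))\<^sup>2)" and "0 < \<epsilon>"
  shows "\<exists>N. \<forall>i\<ge>N. \<forall>j\<ge>N. (\<integral>x. norm (psum a {..<2 ^ i - 1} x - psum a {..<2 ^ j - 1} x) \<partial>M) < \<epsilon>"
proof -
  \<comment> \<open>A tail below \<open>\<epsilon>\<^sup>2 / 2\<close> makes the L^1 bound less than
    \<open>\<epsilon> / 2 + \<epsilon> / 4\<close>.\<close>
  obtain N where N: "\<And>m n. m \<ge> N \<Longrightarrow> \<bar>\<Sum>k=m..<n. (cmod (a k))\<^sup>2\<bar> < \<epsilon>\<^sup>2 / 2"
    using summable \<open>0 < \<epsilon>\<close> unfolding summable_Cauchy by (metis half_gt_zero real_norm_def zero_less_power)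
  have le: "(\<integral>x. norm (psum a {..<2 ^ j - 1} x - psum a {..<2 ^ i - 1} x) \<partial>M) < \<epsilon>"
    if "N \<le> i" "i \<le> j" for i j
  proof -
    define m n :: nat where "m = 2 ^ i - 1" and "n = 2 ^ j - 1"
    have "i < 2 ^ i" by (rule less_exp)
    hence "N \<le> m" unfolding m_def using \<open>N \<le> i\<close> by linarith
    have "m \<le> n" unfolding m_def n_def using \<open>i \<le> j\<close> by (intro diff_le_mono power_increasing) auto
    hence "{..<n} = {..<m} \<union> {m..<n}" by auto
    hence split: "psum a {..<n} x - psum a {..<m} x = psum a {m..<n} x" for x
      unfolding psum_def by (simp add: sum.union_disjoint ivl_disj_int)
    have "(\<integral>x. cmod (psum a {m..<n} x) \<partial>M) \<le> \<epsilon> / 2 + (\<integral>x. (cmod (psum a {m..<n} x))\<^sup>2 \<partial>M) / (2 * \<epsilon>)"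
      using integrable_psum_powr[of "{m..<n}" 2 a] \<open>0 < \<epsilon>\<close>
      by (intro integral_norm_le_square integrable_psum) auto
    also have "\<dots> < \<epsilon> / 2 + (\<epsilon>\<^sup>2 / 2) / (2 * \<epsilon>)"
      using N[OF \<open>N \<le> m\<close>, of n] \<open>0 < \<epsilon>\<close>
      by (intro add_strict_left_mono divide_strict_right_mono) (auto simp: parseval)
    also have "\<dots> \<le> \<epsilon>" using \<open>0 < \<epsilon>\<close> by (simp add: field_simps power2_eq_square)
    finally show ?thesis unfolding m_def[symmetric] n_def[symmetric] split .
  qed
  show ?thesis
  proof (intro exI[of _ N] allI impI)
    fix i j assume ij: "N \<le> i" "N \<le> j"
    show "(\<integral>x. norm (psum a {..<2 ^ i - 1} x - psum a {..<2 ^ j - 1} x) \<partial>M) < \<epsilon>"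
      using le[of i j] le[of j i] ij by (cases "i \<le> j") (simp_all add: norm_minus_commute)
  qed
qed

text \<open>As \<open>f\<close> is only integrable, the limit of the partial sums has to be
  identified. They are Cauchy in L^1 and a subsequence converges almost everywhere to some
  \<open>g\<close>; \<open>g\<close> has the coefficients of \<open>f\<close>, so totality gives
  \<open>g = f\<close>.\<close>

lemma psum_AE_subseq:
  assumes f: "integrable M f" and summable: "summable (\<lambda>n. (cmod (coef f n))\<^sup>2)"
  obtains r :: "nat \<Rightarrow> nat" where "strict_mono r"
    "AE x in M. (\<lambda>i. psum (coef f) {..<2 ^ r i - 1} x) \<longlonglongrightarrow> f x"
proof -
  define S where "S i = psum (coef f) {..<2 ^ i - 1 :: nat}" for i
  have S [measurable]: "S i \<in> borel_measurable M" for i unfolding S_def by measurable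
  have S_int: "integrable M (S i)" for i unfolding S_def by (rule integrable_psum) simp
  have Cauchy: "\<exists>N. \<forall>i\<ge>N. \<forall>j\<ge>N. (\<integral>x. norm (S i x - S j x) \<partial>M) < \<epsilon>" if "0 < \<epsilon>" for \<epsilon>
    unfolding S_def using psum_L1_Cauchy[OF summable that] .
  obtain r where r: "strict_mono r" "AE x in M. Cauchy (\<lambda>i. S (r i) x)"
    using cauchy_L1_AE_cauchy_subseq[OF S_int Cauchy] by blast
  define g where "g x = lim (\<lambda>i. S (r i) x)" for x
  have [measurable]: "g \<in> borel_measurable M"
    unfolding g_def by measurable
  have lim: "AE x in M. (\<lambda>i. S (r i) x) \<longlonglongrightarrow> g x"
    using r(2) by eventually_elim (simp add: g_def Cauchy_convergent_iff convergent_LIMSEQ_iff)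
  \<comment> \<open>Fatou's lemma along the subsequence turns the Cauchy property into L^1
    convergence of the full sequence.\<close>
  have L1: "\<exists>N. \<forall>i\<ge>N. (\<integral>\<^sup>+x. ennreal (norm (S i x - g x)) \<partial>M) \<le> ennreal \<epsilon>" if \<epsilon>: "0 < \<epsilon>" for \<epsilon>
  proof -
    obtain N where N: "\<And>i j. N \<le> i \<Longrightarrow> N \<le> j \<Longrightarrow> (\<integral>x. norm (S i x - S j x) \<partial>M) < \<epsilon>"
      using Cauchy[OF \<epsilon>] by blast
    have "(\<integral>\<^sup>+x. ennreal (norm (S i x - g x)) \<partial>M) \<le> ennreal \<epsilon>" if "N \<le> i" for i
    proof (rule nn_integral_le_of_AE_tendsto[where u = "\<lambda>j x. norm (S i x - S (r j) x)"])
      show "AE x in M. (\<lambda>j. norm (S i x - S (r j) x)) \<longlonglongrightarrow> norm (S i x - g x)"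
        using lim by eventually_elim (intro tendsto_intros)
      show "\<forall>\<^sub>F j in sequentially. (\<integral>\<^sup>+x. ennreal (norm (S i x - S (r j) x)) \<partial>M) \<le> ennreal \<epsilon>"
      proof (rule eventually_sequentiallyI)
        fix j assume "N \<le> j"
        hence "N \<le> r j" using seq_suble[OF r(1), of j] by linarith
        have "(\<integral>\<^sup>+x. ennreal (norm (S i x - S (r j) x)) \<partial>M) = ennreal (\<integral>x. norm (S i x - S (r j) x) \<partial>M)"
          by (intro nn_integral_eq_integral integrable_norm Bochner_Integration.integrable_diff S_int) auto
        thus "(\<integral>\<^sup>+x. ennreal (norm (S i x - S (r j) x)) \<partial>M) \<le> ennreal \<epsilon>"
          using N[OF \<open>N \<le> i\<close> \<open>N \<le> r j\<close>] by (simp add: ennreal_leI)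
      qed
    qed measurable
    thus ?thesis by blast
  qed
  have Sg_int: "integrable M (\<lambda>x. S i x - g x)" if "(\<integral>\<^sup>+x. ennreal (norm (S i x - g x)) \<partial>M) \<le> ennreal \<epsilon>" for i \<epsilon>
    using that by (intro integrableI_bounded) (auto intro: le_less_trans)
  have g_int: "integrable M g"
  proof -
    obtain N where "(\<integral>\<^sup>+x. ennreal (norm (S N x - g x)) \<partial>M) \<le> ennreal 1"
      using L1[of 1] by auto
    hence "integrable M (\<lambda>x. S N x - (S N x - g x))"
      by (intro Bochner_Integration.integrable_diff S_int Sg_int)
    thus ?thesis by simp
  qed
  have coef_g: "coef g n = coef f n" for n
  proof -
    have "cmod (coef f n - coef g n) \<le> real (Suc n) * \<epsilon>" if \<epsilon>: "0 < \<epsilon>" for \<epsilon>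
    proof -
      obtain N where N: "\<And>i. N \<le> i \<Longrightarrow> (\<integral>\<^sup>+x. ennreal (norm (S i x - g x)) \<partial>M) \<le> ennreal \<epsilon>"
        using L1[OF \<epsilon>] by blast
      \<comment> \<open>From \<open>Suc n\<close> on, \<open>n\<close> lies below
        \<open>2 ^ i - 1\<close>, so \<open>S i\<close> already has the n-th coefficient of
        \<open>f\<close>.\<close>
      define i where "i = max N (Suc n)"
      have "Suc n < 2 ^ Suc n" by (rule less_exp)
      also have "\<dots> \<le> 2 ^ i" unfolding i_def by (intro power_increasing) auto
      finally have "coef f n = coef (S i) n" unfolding S_def by (simp add: coef_psum)
      hence "coef f n - coef g n = (\<integral>x. (S i x - g x) * complex_of_real (e n x) \<partial>M)"
        unfolding coef_def left_diff_distrib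
        by (simp add: integrable_mult_e S_int g_int)
      hence "cmod (coef f n - coef g n) \<le> (\<integral>x. norm ((S i x - g x) * complex_of_real (e n x)) \<partial>M)"
        by (metis integral_norm_bound)
      also have "\<dots> \<le> (\<integral>x. real (Suc n) * norm (S i x - g x) \<partial>M)"
      proof (rule integral_mono)
        fix x assume "x \<in> space M"
        hence "norm (S i x - g x) * \<bar>e n x\<bar> \<le> norm (S i x - g x) * real (Suc n)"
          by (intro mult_left_mono e_bound) auto
        thus "norm ((S i x - g x) * complex_of_real (e n x)) \<le> real (Suc n) * norm (S i x - g x)"
          by (simp only: norm_mult norm_of_real mult.commute)
      qed (intro integrable_norm integrable_mult_e integrable_mult_right Bochner_Integration.integrable_diff S_int g_int)+
      also have "\<dots> = real (Suc n) * (\<integral>x. norm (S i x - g x) \<partial>M)" by simp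
      also have "(\<integral>x. norm (S i x - g x) \<partial>M) \<le> \<epsilon>"
      proof -
        have "ennreal (\<integral>x. norm (S i x - g x) \<partial>M) = (\<integral>\<^sup>+x. ennreal (norm (S i x - g x)) \<partial>M)"
          by (intro nn_integral_eq_integral[symmetric] integrable_norm Bochner_Integration.integrable_diff S_int g_int) auto
        also have "\<dots> \<le> ennreal \<epsilon>" by (rule N) (simp add: i_def)
        finally show ?thesis using \<epsilon> by simp
      qed
      finally show ?thesis by simp
    qed
    from this[of "\<epsilon> / real (Suc n)" for \<epsilon>]
    have "cmod (coef f n - coef g n) \<le> 0 + \<epsilon>" if "0 < \<epsilon>" for \<epsilon>
      using that by simp
    hence "cmod (coef f n - coef g n) \<le> 0" by (rule field_le_epsilon)
    thus ?thesis by simp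
  qed
  have "AE x in M. f x - g x = 0"
  proof (rule e_total)
    show "integrable M (\<lambda>x. f x - g x)" using f g_int by simp
    show "(\<integral>x. (f x - g x) * complex_of_real (e n x) \<partial>M) = 0" for n
      using coef_g[of n] f g_int by (simp add: coef_def left_diff_distrib integrable_mult_e)
  qed
  hence "AE x in M. (\<lambda>i. S (r i) x) \<longlonglongrightarrow> f x"
    using lim by eventually_elim simp
  thus thesis using r(1) that unfolding S_def by blast
qed

text \<open>Fatou's lemma carries the uniform bound from the partial sums to \<open>f\<close>,
  giving integrability and the estimate together.\<close>

theorem lp_bound_of_coef:
  assumes p: "2 \<le> p"
  obtains C where "C > 0"
    "\<And>f. integrable M f \<Longrightarrow> summable (\<lambda>n. real (Suc n) powr (4 * p - 8) * cmod (coef f n) powr p) \<Longrightarrow>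
       integrable M (\<lambda>x. cmod (f x) powr p) \<and>
       (\<integral>x. cmod (f x) powr p \<partial>M) \<le> C * (\<Sum>n. real (Suc n) powr (4 * p - 8) * cmod (coef f n) powr p)"
proof -
  obtain C where C: "C > 0"
    "\<And>a K. (\<integral>x. cmod (psum a {..<2 ^ K - 1} x) powr p \<partial>M)
        \<le> C * (\<Sum>n<2 ^ K - 1. real (Suc n) powr (4 * p - 8) * cmod (a n) powr p)"
    using psum_powr_bound[OF p] by blast
  show thesis
  proof (rule that[OF C(1)])
    fix f assume f: "integrable M f"
      and summable: "summable (\<lambda>n. real (Suc n) powr (4 * p - 8) * cmod (coef f n) powr p)"
    have f_meas [measurable]: "f \<in> borel_measurable M" using f by (rule borel_measurable_integrable)
    define B where "B = C * (\<Sum>n. real (Suc n) powr (4 * p - 8) * cmod (coef f n) powr p)"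
    obtain r where r: "strict_mono r" "AE x in M. (\<lambda>i. psum (coef f) {..<2 ^ r i - 1} x) \<longlonglongrightarrow> f x"
      using psum_AE_subseq[OF f summable_coef_square[OF p summable]] by blast
    have "0 \<le> B" unfolding B_def using C(1) by (intro mult_nonneg_nonneg suminf_nonneg summable) auto
    have le: "(\<integral>\<^sup>+x. ennreal (cmod (f x) powr p) \<partial>M) \<le> ennreal B"
    proof (rule nn_integral_le_of_AE_tendsto[where u = "\<lambda>i x. cmod (psum (coef f) {..<2 ^ r i - 1} x) powr p"])
      show "AE x in M. (\<lambda>i. cmod (psum (coef f) {..<2 ^ r i - 1} x) powr p) \<longlonglongrightarrow> cmod (f x) powr p"
        using r(2)
      proof eventually_elim
        case (elim x)
        show ?case using p by (intro tendsto_powr' tendsto_norm elim tendsto_const) auto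
      qed
      show "\<forall>\<^sub>F i in sequentially. (\<integral>\<^sup>+x. ennreal (cmod (psum (coef f) {..<2 ^ r i - 1} x) powr p) \<partial>M) \<le> ennreal B"
      proof (intro always_eventually allI)
        fix i
        have "(\<integral>\<^sup>+x. ennreal (cmod (psum (coef f) {..<2 ^ r i - 1} x) powr p) \<partial>M)
            = ennreal (\<integral>x. cmod (psum (coef f) {..<2 ^ r i - 1} x) powr p \<partial>M)"
          using p by (intro nn_integral_eq_integral integrable_psum_powr) auto
        also have "\<dots> \<le> ennreal (C * (\<Sum>n<2 ^ r i - 1. real (Suc n) powr (4 * p - 8) * cmod (coef f n) powr p))"
          by (intro ennreal_leI C(2))
        also have "\<dots> \<le> ennreal B"
          unfolding B_def using C(1) by (intro ennreal_leI mult_left_mono sum_le_suminf summable) auto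
        finally show "(\<integral>\<^sup>+x. ennreal (cmod (psum (coef f) {..<2 ^ r i - 1} x) powr p) \<partial>M) \<le> ennreal B" .
      qed
    qed measurable
    have int: "integrable M (\<lambda>x. cmod (f x) powr p)"
      using le by (intro integrableI_nonneg) (auto intro: le_less_trans)
    have "ennreal (\<integral>x. cmod (f x) powr p \<partial>M) \<le> ennreal B"
      using le by (subst nn_integral_eq_integral[OF int, symmetric]) auto
    hence "(\<integral>x. cmod (f x) powr p \<partial>M) \<le> B"
      using \<open>0 \<le> B\<close> by simp
    with int show "integrable M (\<lambda>x. cmod (f x) powr p) \<and>
       (\<integral>x. cmod (f x) powr p \<partial>M) \<le> C * (\<Sum>n. real (Suc n) powr (4 * p - 8) * cmod (coef f n) powr p)"
      unfolding B_def by blast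
  qed
qed

end

section \<open>Totality of the characters\<close>

text \<open>The positive and negative parts of \<open>h\<close> are densities of finite measures
  that agree on half-lines, hence coincide; so the two parts agree almost everywhere.\<close>

lemma AE_zero_of_integral_greaterThan_zero:
  fixes h :: "real \<Rightarrow> real"
  assumes sets: "sets M = sets (restrict_space borel S)" and S: "S \<in> sets borel"
    and h: "integrable M h"
    and zero: "\<And>c. (\<integral>x. h x * indicator {c<..} x \<partial>M) = 0"
  shows "AE x in M. h x = 0"
proof -
  have [measurable]: "(\<lambda>x. x) \<in> borel_measurable M"
    unfolding measurable_cong_sets[OF sets refl] by (intro measurable_restrict_space1 measurable_ident_sets) simp
  have [measurable]: "h \<in> borel_measurable M" using h by (rule borel_measurable_integrable)
  have space: "space M = S"
    using sets_eq_imp_space_eq[OF sets] by (simp add: space_restrict_space)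
  have ind: "integrable M (\<lambda>x. g x * indicator {c<..} x)" if g: "integrable M g" for g :: "real \<Rightarrow> real" and c
  proof (rule Bochner_Integration.integrable_bound[OF g])
    have "(\<lambda>x. indicator {c<..} x :: real) \<in> borel_measurable M"
      by (rule measurable_compose[of "\<lambda>x. x" M borel "indicator {c<..}"]) measurable
    thus "(\<lambda>x. g x * indicator {c<..} x) \<in> borel_measurable M"
      by (rule borel_measurable_times[OF borel_measurable_integrable[OF g]])
  qed (auto simp: indicator_def)
  \<comment> \<open>\<open>ennreal\<close> truncates at 0, so \<open>P 1\<close> and
    \<open>P (-1)\<close> have the positive and the negative part of \<open>h\<close> as
    densities.\<close>
  define P where "P s = density M (\<lambda>x. ennreal (s * h x))" for s :: real
  have em: "emeasure (distr (P s) borel (\<lambda>x. x)) {c<..} = ennreal (\<integral>x. max 0 (s * h x) * indicator {c<..} x \<partial>M)" for s c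
  proof -
    have [measurable]: "{c<..} \<inter> S \<in> sets M"
      unfolding sets using S by (auto simp: sets_restrict_space)
    have "emeasure (distr (P s) borel (\<lambda>x. x)) {c<..} = emeasure (P s) ({c<..} \<inter> S)"
      by (subst emeasure_distr) (auto simp: P_def space vimage_def Int_def)
    also have "\<dots> = (\<integral>\<^sup>+x. ennreal (s * h x) * indicator ({c<..} \<inter> S) x \<partial>M)"
      unfolding P_def by (intro emeasure_density) measurable
    also have "\<dots> = (\<integral>\<^sup>+x. ennreal (max 0 (s * h x) * indicator {c<..} x) \<partial>M)"
      by (intro nn_integral_cong) (auto simp: space indicator_def max_def ennreal_neg)
    also have "\<dots> = ennreal (\<integral>x. max 0 (s * h x) * indicator {c<..} x \<partial>M)"
      using h by (intro nn_integral_eq_integral ind integrable_max AE_I2) auto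
    finally show ?thesis .
  qed
  have "(\<integral>x. max 0 (1 * h x) * indicator {c<..} x \<partial>M) - (\<integral>x. max 0 ((-1) * h x) * indicator {c<..} x \<partial>M) = 0" for c
  proof -
    have "(\<integral>x. max 0 (1 * h x) * indicator {c<..} x \<partial>M) - (\<integral>x. max 0 ((-1) * h x) * indicator {c<..} x \<partial>M)
      = (\<integral>x. max 0 (1 * h x) * indicator {c<..} x - max 0 ((-1) * h x) * indicator {c<..} x \<partial>M)"
      using h by (intro Bochner_Integration.integral_diff[symmetric] ind integrable_max) auto
    also have "\<dots> = (\<integral>x. h x * indicator {c<..} x \<partial>M)"
      by (intro Bochner_Integration.integral_cong) (auto simp: max_def indicator_def)
    finally show ?thesis using zero by simp
  qed
  hence "emeasure (distr (P 1) borel (\<lambda>x. x)) {c<..} = emeasure (distr (P (-1)) borel (\<lambda>x. x)) {c<..}" for c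
    unfolding em by simp
  \<comment> \<open>Half-lines determine a finite Borel measure on the whole line, which is why the
    measures are pushed forward from \<open>S\<close>.\<close>
  hence eq: "distr (P 1) borel (\<lambda>x. x) = distr (P (-1)) borel (\<lambda>x. x)"
    by (intro measure_eqI_lessThan) (auto simp: em)
  have "P 1 = P (-1)"
  proof (rule measure_eqI)
    show "sets (P 1) = sets (P (-1))" by (simp add: P_def)
    fix A assume "A \<in> sets (P 1)"
    hence "A \<in> sets (restrict_space borel S)" by (simp add: P_def sets)
    hence A: "A \<in> sets borel" "A \<subseteq> S" using S by (auto simp: sets_restrict_space_iff)
    have "emeasure (P s) A = emeasure (distr (P s) borel (\<lambda>x. x)) A" for s
      using A by (subst emeasure_distr) (auto simp: P_def space intro!: arg_cong[where f = "emeasure _"])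
    thus "emeasure (P 1) A = emeasure (P (-1)) A" using eq by simp
  qed
  moreover have "(\<integral>\<^sup>+x. ennreal (1 * h x) \<partial>M) \<noteq> \<infinity>"
    using h by (simp add: real_integrable_def)
  ultimately have "AE x in M. ennreal (1 * h x) = ennreal ((-1) * h x)"
    unfolding P_def by (subst (asm) finite_density_unique) auto
  thus ?thesis
  proof eventually_elim
    case (elim x)
    thus ?case by (cases "h x \<ge> 0") (auto simp: ennreal_neg ennreal_eq_0_iff)
  qed
qed

text \<open>Continuous ramps \<open>\<phi> k\<close> converge pointwise to the indicator of a
  half-line, and |h| dominates the products.\<close>

lemma AE_zero_of_integral_continuous_zero:
  fixes h :: "real \<Rightarrow> real"
  assumes sets: "sets M = sets (restrict_space borel S)" and S: "S \<in> sets borel"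
    and h: "integrable M h"
    and zero: "\<And>\<phi>. continuous_on UNIV \<phi> \<Longrightarrow> (\<integral>x. h x * \<phi> x \<partial>M) = 0"
  shows "AE x in M. h x = 0"
proof (rule AE_zero_of_integral_greaterThan_zero[OF sets S h])
  fix c :: real
  have [measurable]: "(\<lambda>x. x) \<in> borel_measurable M"
    unfolding measurable_cong_sets[OF sets refl] by (intro measurable_restrict_space1 measurable_ident_sets) simp
  have [measurable]: "h \<in> borel_measurable M" using h by (rule borel_measurable_integrable)
  define \<phi> where "\<phi> k x = min 1 (max 0 (real k * (x - c)))" for k :: nat and x
  have [measurable]: "\<phi> k \<in> borel_measurable M" for k unfolding \<phi>_def by measurable
  have [measurable]: "(\<lambda>x. indicator {c<..} x :: real) \<in> borel_measurable M"
    by (rule measurable_compose[of "\<lambda>x. x" M borel "indicator {c<..}"]) measurable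
  have "(\<lambda>k. \<integral>x. h x * \<phi> k x \<partial>M) \<longlonglongrightarrow> (\<integral>x. h x * indicator {c<..} x \<partial>M)"
  proof (rule integral_dominated_convergence[where w = "\<lambda>x. \<bar>h x\<bar>"])
    have "(\<lambda>k. \<phi> k x) \<longlonglongrightarrow> indicator {c<..} x" for x
    proof (cases "x > c")
      case False
      hence "real k * (x - c) \<le> 0" for k by (simp add: mult_le_0_iff)
      hence "\<phi> k x = 0" for k by (simp add: \<phi>_def max_absorb1)
      thus ?thesis using False by simp
    next
      case True
      obtain K :: nat where K: "1 / (x - c) \<le> real K" using real_arch_simple by blast
      have "\<phi> k x = 1" if "k \<ge> K" for k
      proof -
        have "1 / (x - c) \<le> real k" using K that by linarith
        thus ?thesis using True by (simp add: \<phi>_def field_simps)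
      qed
      hence "eventually (\<lambda>k. \<phi> k x = 1) sequentially" by (rule eventually_sequentiallyI)
      thus ?thesis using True by (simp add: tendsto_eventually)
    qed
    thus "AE x in M. (\<lambda>k. h x * \<phi> k x) \<longlonglongrightarrow> h x * indicator {c<..} x"
      by (intro AE_I2 tendsto_intros)
    show "AE x in M. norm (h x * \<phi> k x) \<le> \<bar>h x\<bar>" for k
      by (intro AE_I2) (auto simp: \<phi>_def abs_mult intro!: mult_left_le)
    show "(\<lambda>x. h x * \<phi> k x) \<in> borel_measurable M" for k by measurable
    show "(\<lambda>x. h x * indicator {c<..} x) \<in> borel_measurable M" by measurable
    show "integrable M (\<lambda>x. \<bar>h x\<bar>)" using h by (rule integrable_abs)
  qed
  moreover have "(\<integral>x. h x * \<phi> k x \<partial>M) = 0" for k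
    unfolding \<phi>_def by (intro zero continuous_intros)
  ultimately show "(\<integral>x. h x * indicator {c<..} x \<partial>M) = 0"
    by (simp add: LIMSEQ_const_iff)
qed

text \<open>Vanishing against all \<open>chebyshev_U n\<close> gives vanishing against powers of
  \<open>cos (pi * t)\<close>, and by Weierstrass against all continuous functions.\<close>

lemma chebyshev_U_total_real:
  fixes h :: "real \<Rightarrow> real"
  assumes sets: "sets M = sets (restrict_space borel {0..1})" and h: "integrable M h"
    and zero: "\<And>n. (\<integral>t. h t * poly (chebyshev_U n) (cos (pi * t)) \<partial>M) = 0"
  shows "AE t in M. h t = 0"
proof (rule AE_zero_of_integral_continuous_zero[OF sets _ h])
  have space: "space M = {0..1}"
    using sets_eq_imp_space_eq[OF sets] by (simp add: space_restrict_space)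
  have [measurable]: "(\<lambda>x. x) \<in> borel_measurable M"
    unfolding measurable_cong_sets[OF sets refl] by (intro measurable_restrict_space1 measurable_ident_sets) simp
  have meas: "g \<in> borel_measurable M" if "continuous_on UNIV g" for g :: "real \<Rightarrow> real"
    using borel_measurable_continuous_onI[OF that] by measurable
  have [measurable]: "h \<in> borel_measurable M" using h by (rule borel_measurable_integrable)
  have int: "integrable M (\<lambda>t. h t * g t)" if g: "continuous_on UNIV g" for g :: "real \<Rightarrow> real"
  proof -
    have "compact (g ` {0..1})" using g by (intro compact_continuous_image) (auto intro: continuous_on_subset)
    then obtain B where B: "\<And>t. t \<in> {0..1} \<Longrightarrow> \<bar>g t\<bar> \<le> B"
      unfolding real_norm_def[symmetric] by (meson bounded_iff compact_imp_bounded imageI)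
    show ?thesis
    proof (rule Bochner_Integration.integrable_bound)
      show "integrable M (\<lambda>t. B * h t)" using h by simp
      show "AE t in M. norm (h t * g t) \<le> norm (B * h t)"
      proof (intro AE_I2)
        fix t assume "t \<in> space M"
        hence "\<bar>h t\<bar> * \<bar>g t\<bar> \<le> \<bar>h t\<bar> * \<bar>B\<bar>" using B[of t] by (intro mult_left_mono) (auto simp: space)
        thus "norm (h t * g t) \<le> norm (B * h t)" by (simp add: abs_mult mult.commute)
      qed
    qed (use meas[OF g] in measurable)
  qed
  \<comment> \<open>Multiplying \<open>chebyshev_U n\<close> by the cosine gives half the sum of its
    neighbours, so the induction on \<open>k\<close> runs over all \<open>n\<close> at once.\<close>
  have powU: "(\<integral>t. h t * (cos (pi * t) ^ k * poly (chebyshev_U n) (cos (pi * t))) \<partial>M) = 0" for k n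
  proof (induction k arbitrary: n)
    case 0
    show ?case using zero[of n] by simp
  next
    case (Suc k)
    show ?case
    proof (cases n)
      case 0
      have "(\<integral>t. h t * (cos (pi * t) ^ k * poly (chebyshev_U (Suc 0)) (cos (pi * t))) \<partial>M)
        = (\<integral>t. 2 * (h t * (cos (pi * t) ^ Suc k * poly (chebyshev_U 0) (cos (pi * t)))) \<partial>M)"
        by (intro Bochner_Integration.integral_cong) auto
      thus ?thesis using Suc[of "Suc 0"] 0 by simp
    next
      case (Suc j)
      have "(\<integral>t. h t * (cos (pi * t) ^ k * poly (chebyshev_U (Suc (Suc j))) (cos (pi * t))) \<partial>M)
        + (\<integral>t. h t * (cos (pi * t) ^ k * poly (chebyshev_U j) (cos (pi * t))) \<partial>M)
        = (\<integral>t. h t * (cos (pi * t) ^ k * poly (chebyshev_U (Suc (Suc j))) (cos (pi * t)))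
              + h t * (cos (pi * t) ^ k * poly (chebyshev_U j) (cos (pi * t))) \<partial>M)"
        by (intro Bochner_Integration.integral_add[symmetric] int continuous_intros)
      also have "\<dots> = (\<integral>t. 2 * (h t * (cos (pi * t) ^ Suc k * poly (chebyshev_U (Suc j)) (cos (pi * t)))) \<partial>M)"
        by (intro Bochner_Integration.integral_cong) (auto simp: algebra_simps)
      finally show ?thesis using Suc.IH[of "Suc (Suc j)"] Suc.IH[of j] Suc by simp
    qed
  qed
  have cos_power: "(\<integral>t. h t * cos (pi * t) ^ k \<partial>M) = 0" for k
    using powU[of k 0] by simp
  fix \<phi> :: "real \<Rightarrow> real" assume \<phi>: "continuous_on UNIV \<phi>"
  have "\<bar>\<integral>t. h t * \<phi> t \<partial>M\<bar> \<le> \<epsilon> * (\<integral>t. \<bar>h t\<bar> \<partial>M)" if "0 < \<epsilon>" for \<epsilon>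
  proof -
    \<comment> \<open>In the variable \<open>y = cos (pi * t)\<close>, polynomial approximants
      become combinations of cosine powers.\<close>
    have "continuous_on {-1..1} (\<lambda>y. \<phi> (arccos y / pi))"
      by (intro continuous_on_compose2[OF \<phi>] continuous_intros) auto
    then obtain q where q: "real_polynomial_function q" "\<And>y. y \<in> {-1..1} \<Longrightarrow> \<bar>\<phi> (arccos y / pi) - q y\<bar> < \<epsilon>"
      using Stone_Weierstrass_real_polynomial_function[of "{-1..1}" "\<lambda>y. \<phi> (arccos y / pi)" \<epsilon>] \<open>0 < \<epsilon>\<close>
      by auto
    obtain a n where qa: "q = (\<lambda>y. \<Sum>i\<le>n. a i * y ^ i)"
      using q(1) unfolding real_polynomial_function_iff_sum by blast
    have cont: "continuous_on UNIV (\<lambda>t. q (cos (pi * t)))"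
      unfolding qa by (intro continuous_intros)
    have "(\<integral>t. h t * q (cos (pi * t)) \<partial>M) = (\<integral>t. (\<Sum>i\<le>n. a i * (h t * cos (pi * t) ^ i)) \<partial>M)"
      unfolding qa by (simp add: sum_distrib_left mult_ac)
    also have "\<dots> = (\<Sum>i\<le>n. \<integral>t. a i * (h t * cos (pi * t) ^ i) \<partial>M)"
      by (intro Bochner_Integration.integral_sum integrable_mult_right int continuous_intros)
    also have "\<dots> = 0" by (simp add: cos_power)
    finally have "(\<integral>t. h t * \<phi> t \<partial>M) = (\<integral>t. h t * \<phi> t \<partial>M) - (\<integral>t. h t * q (cos (pi * t)) \<partial>M)"
      by simp
    also have "\<dots> = (\<integral>t. h t * \<phi> t - h t * q (cos (pi * t)) \<partial>M)"
      by (intro Bochner_Integration.integral_diff[symmetric] int \<phi> cont)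
    finally have "\<bar>\<integral>t. h t * \<phi> t \<partial>M\<bar> \<le> (\<integral>t. \<bar>h t * \<phi> t - h t * q (cos (pi * t))\<bar> \<partial>M)"
      using integral_abs_bound by metis
    also have "\<dots> \<le> (\<integral>t. \<epsilon> * \<bar>h t\<bar> \<partial>M)"
    proof (rule integral_mono)
      show "integrable M (\<lambda>t. \<bar>h t * \<phi> t - h t * q (cos (pi * t))\<bar>)"
        by (intro integrable_abs Bochner_Integration.integrable_diff int \<phi> cont)
      show "integrable M (\<lambda>t. \<epsilon> * \<bar>h t\<bar>)" using h by simp
      fix t assume "t \<in> space M"
      hence t: "0 \<le> pi * t" "pi * t \<le> pi" by (auto simp: space mult_left_le)
      have "\<bar>\<phi> t - q (cos (pi * t))\<bar> \<le> \<epsilon>"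
        using q(2)[of "cos (pi * t)"] by (simp add: arccos_cos[OF t])
      hence "\<bar>h t\<bar> * \<bar>\<phi> t - q (cos (pi * t))\<bar> \<le> \<bar>h t\<bar> * \<epsilon>" by (intro mult_left_mono) auto
      thus "\<bar>h t * \<phi> t - h t * q (cos (pi * t))\<bar> \<le> \<epsilon> * \<bar>h t\<bar>"
        by (simp only: abs_mult mult.commute[of "\<bar>h t\<bar>" \<epsilon>] flip: right_diff_distrib)
    qed
    also have "\<dots> = \<epsilon> * (\<integral>t. \<bar>h t\<bar> \<partial>M)" by simp
    finally show ?thesis .
  qed
  note le = this
  have "\<bar>\<integral>t. h t * \<phi> t \<partial>M\<bar> \<le> 0 + \<epsilon>" if "0 < \<epsilon>" for \<epsilon>
  proof -
    \<comment> \<open>Dividing by \<open>1 + I\<close> instead of \<open>I\<close> also covers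
      \<open>I = 0\<close>.\<close>
    define I where "I = (\<integral>t. \<bar>h t\<bar> \<partial>M)"
    have I: "0 < 1 + I" by (simp add: I_def add_pos_nonneg)
    have "\<bar>\<integral>t. h t * \<phi> t \<partial>M\<bar> \<le> \<epsilon> / (1 + I) * I"
      unfolding I_def using I \<open>0 < \<epsilon>\<close> by (intro le divide_pos_pos) (simp_all add: I_def)
    also have "\<dots> \<le> \<epsilon>" using I \<open>0 < \<epsilon>\<close> by (simp add: pos_divide_le_eq algebra_simps)
    finally show ?thesis by simp
  qed
  hence "\<bar>\<integral>t. h t * \<phi> t \<partial>M\<bar> \<le> 0" by (rule field_le_epsilon)
  thus "(\<integral>t. h t * \<phi> t \<partial>M) = 0" by simp
qed simp

lemma chebyshev_U_total:
  fixes h :: "real \<Rightarrow> complex"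
  assumes sets: "sets M = sets (restrict_space borel {0..1})" and h: "integrable M h"
    and zero: "\<And>n. (\<integral>t. h t * complex_of_real (poly (chebyshev_U n) (cos (pi * t))) \<partial>M) = 0"
  shows "AE t in M. h t = 0"
proof -
  have int: "integrable M (\<lambda>t. h t * complex_of_real (poly (chebyshev_U n) (cos (pi * t))))" for n
  proof (rule Bochner_Integration.integrable_bound)
    show "integrable M (\<lambda>t. real (Suc n) * norm (h t))"
      using h by (intro integrable_mult_right integrable_norm)
    have "(\<lambda>t. complex_of_real (poly (chebyshev_U n) (cos (pi * t)))) \<in> borel_measurable M"
      unfolding measurable_cong_sets[OF sets refl]
      by (intro borel_measurable_continuous_on_restrict continuous_intros)
    thus "(\<lambda>t. h t * complex_of_real (poly (chebyshev_U n) (cos (pi * t)))) \<in> borel_measurable M"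
      using h by (intro borel_measurable_times borel_measurable_integrable[OF h])
    show "AE t in M. norm (h t * complex_of_real (poly (chebyshev_U n) (cos (pi * t))))
        \<le> norm (real (Suc n) * norm (h t))"
    proof (intro AE_I2)
      fix t
      have "norm (h t) * \<bar>poly (chebyshev_U n) (cos (pi * t))\<bar> \<le> norm (h t) * real (Suc n)"
        by (intro mult_left_mono chebyshev_U_cos_bound) simp
      thus "norm (h t * complex_of_real (poly (chebyshev_U n) (cos (pi * t))))
          \<le> norm (real (Suc n) * norm (h t))"
        by (simp add: norm_mult mult.commute)
    qed
  qed
  have "AE t in M. Re (h t) = 0"
    using h integral_Re[OF int] zero by (intro chebyshev_U_total_real[OF sets]) simp_all
  moreover have "AE t in M. Im (h t) = 0"
    using h integral_Im[OF int] zero by (intro chebyshev_U_total_real[OF sets]) simp_all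
  ultimately show ?thesis by eventually_elim (simp add: complex_eq_iff)
qed

section \<open>The hypergroup of conjugacy classes\<close>

context haar_SU2
begin

definition \<tau> :: "complex^2^2 \<Rightarrow> real" where
  "\<tau> x = arccos (X 0 x) / pi"

lemma X0_bound: "x \<in> SU2 \<Longrightarrow> -1 \<le> X 0 x \<and> X 0 x \<le> 1"
  using X_bound[of x 0] by auto

lemma measurable_\<tau>: "\<tau> \<in> measurable \<mu> (restrict_space borel {0..1})"
proof (rule measurable_restrict_space2)
  show "\<tau> \<in> space \<mu> \<rightarrow> {0..1}"
    using X0_bound by (auto simp: space_haar \<tau>_def arccos_lbound arccos_ubound divide_le_eq)
  have "continuous_on SU2 \<tau>"
    unfolding \<tau>_def using X0_bound by (auto simp: X_def intro!: continuous_intros)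
  thus "\<tau> \<in> borel_measurable \<mu>"
    unfolding measurable_cong_sets[OF sets_haar refl] by (rule borel_measurable_continuous_on_restrict)
qed

lemma cos_\<tau>: "x \<in> SU2 \<Longrightarrow> cos (pi * \<tau> x) = X 0 x"
  using X0_bound by (simp add: \<tau>_def)

text \<open>This replaces the definite description by a continuous function of the trace, making the
  change of variables available.\<close>

lemma conj_haar_eq: "conj_haar \<mu> = distr \<mu> (restrict_space borel {0..1}) \<tau>"
  unfolding conj_haar_def
  by (intro distr_cong refl) (simp add: space_haar class_coord_conj_class \<tau>_def X_def)

lemma sets_conj_haar: "sets (conj_haar \<mu>) = sets (restrict_space borel {0..1})"
  by (simp add: conj_haar_def)

lemma space_conj_haar: "space (conj_haar \<mu>) = {0..1}"
  by (simp add: conj_haar_def space_restrict_space)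

lemma prob_space_conj_haar: "prob_space (conj_haar \<mu>)"
  unfolding conj_haar_eq by (rule prob_space_distr[OF measurable_\<tau>])

text \<open>The trace of the representation of dimension \<open>Suc n\<close>, written without the
  quotient of sines and so valid at the endpoints.\<close>

definition e :: "nat \<Rightarrow> real \<Rightarrow> real" where
  "e n t = poly (chebyshev_U n) (cos (pi * t))"

lemma e_measurable: "e n \<in> borel_measurable (conj_haar \<mu>)"
  unfolding measurable_cong_sets[OF sets_conj_haar refl] e_def
  by (intro borel_measurable_continuous_on_restrict continuous_intros)

lemma e_le: "\<bar>e n t\<bar> \<le> real (Suc n)"
  unfolding e_def by (rule chebyshev_U_cos_bound)

sublocale characters: bounded_orthonormal_system "conj_haar \<mu>" e
proof (intro bounded_orthonormal_system.intro bounded_orthonormal_system_axioms.intro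
    prob_space_conj_haar e_measurable e_le)
  show "(\<integral>t. e i t * e j t \<partial>conj_haar \<mu>) = (if i = j then 1 else 0)" for i j
  proof -
    have "(\<lambda>t. e i t * e j t) \<in> borel_measurable (conj_haar \<mu>)"
      by (intro borel_measurable_times e_measurable)
    hence "(\<integral>t. e i t * e j t \<partial>conj_haar \<mu>) = (\<integral>x. e i (\<tau> x) * e j (\<tau> x) \<partial>\<mu>)"
      unfolding conj_haar_eq by (intro integral_distr[OF measurable_\<tau>]) simp
    also have "\<dots> = (\<integral>x. poly (chebyshev_U i) (X 0 x) * poly (chebyshev_U j) (X 0 x) \<partial>\<mu>)"
      by (intro Bochner_Integration.integral_cong) (simp_all add: e_def space_haar cos_\<tau>)
    finally show ?thesis by (simp add: chebyshev_U_orthonormal)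
  qed
next
  fix h :: "real \<Rightarrow> complex"
  assume h: "integrable (conj_haar \<mu>) h"
    and zero: "\<And>n. (\<integral>t. h t * complex_of_real (e n t) \<partial>conj_haar \<mu>) = 0"
  show "AE t in conj_haar \<mu>. h t = 0"
    using zero by (intro chebyshev_U_total[OF sets_conj_haar h]) (simp add: e_def)
qed

end

text \<open>Inside the interval this is \<open>chebyshev_U_cos\<close>; at the endpoints
  \<open>psi\<close> is a limit of values of a continuous function.\<close>

lemma psi_eq_chebyshev_U:
  assumes t: "t \<in> {0..1}"
  shows "psi (real n / 2) t = poly (chebyshev_U n) (cos (pi * t))"
proof -
  have quot: "sin ((2 * (real n / 2) + 1) * pi * s) / sin (pi * s) = poly (chebyshev_U n) (cos (pi * s))"
    if "s \<in> {0<..<1}" for s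
  proof -
    have "sin (pi * s) > 0" using that by (intro sin_gt_zero) auto
    moreover have "(2 * (real n / 2) + 1) * pi * s = real (Suc n) * (pi * s)" by simp
    ultimately show ?thesis
      by (simp only: flip: chebyshev_U_cos) simp
  qed
  show ?thesis
  proof (cases "t \<in> {0<..<1}")
    case True
    thus ?thesis using quot by (simp add: psi_def)
  next
    case False
    with t have "t = 0 \<or> t = 1" by auto
    \<comment> \<open>Being a limit point makes the filter nontrivial, so that \<open>Lim\<close>
      denotes the unique limit.\<close>
    hence "t islimpt {0<..<1::real}"
      using islimpt_greaterThanLessThan1[of 0 "1::real"] islimpt_greaterThanLessThan2[of 0 "1::real"] by auto
    hence nontriv: "at t within {0<..<1} \<noteq> bot" by (simp add: trivial_limit_within)
    have "((\<lambda>s. poly (chebyshev_U n) (cos (pi * s))) \<longlongrightarrow> poly (chebyshev_U n) (cos (pi * t))) (at t within {0<..<1})"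
      by (intro tendsto_intros)
    moreover have "eventually (\<lambda>s. poly (chebyshev_U n) (cos (pi * s))
        = sin ((2 * (real n / 2) + 1) * pi * s) / sin (pi * s)) (at t within {0<..<1})"
      unfolding eventually_at_filter by (intro always_eventually allI impI quot[symmetric])
    ultimately have "((\<lambda>s. sin ((2 * (real n / 2) + 1) * pi * s) / sin (pi * s))
        \<longlongrightarrow> poly (chebyshev_U n) (cos (pi * t))) (at t within {0<..<1})"
      by (rule Lim_transform_eventually)
    from tendsto_Lim[OF nontriv this] show ?thesis
      using False unfolding psi_def by (simp only: if_False)
  qed
qed

section \<open>From hypergroup characters to the orthonormal system\<close>

context haar_SU2
begin

lemma fourier_coeff_eq: "fourier_coeff (conj_haar \<mu>) f (real n / 2) = characters.coef f n / of_nat (Suc n)"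
proof -
  have "fourier_coeff (conj_haar \<mu>) f (real n / 2)
      = (\<integral>t. (f t * complex_of_real (e n t)) / of_nat (Suc n) \<partial>conj_haar \<mu>)"
    unfolding fourier_coeff_def
  proof (intro Bochner_Integration.integral_cong refl)
    fix t assume "t \<in> space (conj_haar \<mu>)"
    hence "psi (real n / 2) t = e n t"
      unfolding e_def space_conj_haar by (rule psi_eq_chebyshev_U)
    thus "f t * cnj (hyp_char (real n / 2) t) = f t * complex_of_real (e n t) / of_nat (Suc n)"
      by (simp add: hyp_char_def add.commute)
  qed
  thus ?thesis by (simp only: integral_divide_zero characters.coef_def)
qed

text \<open>\<open>hyp_char\<close> is divided by the dimension; the p-th power of this factor
  lowers the exponent \<open>5 * p - 8\<close> to \<open>4 * p - 8\<close>.\<close>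

lemma weighted_fourier_coeff_eq:
  "(2 * (real n / 2) + 1) powr (5 * p - 8) * norm (fourier_coeff (conj_haar \<mu>) f (real n / 2)) powr p
     = real (Suc n) powr (4 * p - 8) * norm (characters.coef f n) powr p"
proof -
  have "norm (fourier_coeff (conj_haar \<mu>) f (real n / 2)) powr p
     = norm (characters.coef f n) powr p * real (Suc n) powr (- p)"
    unfolding fourier_coeff_eq norm_divide norm_of_nat by (simp add: powr_divide powr_minus_divide)
  moreover have "real (Suc n) powr (5 * p - 8) * real (Suc n) powr (- p) = real (Suc n) powr (4 * p - 8)"
    by (simp flip: powr_add)
  moreover have "2 * (real n / 2) + 1 = real (Suc n)" by simp
  ultimately show ?thesis by (simp only: mult.assoc mult.commute[of "norm _ powr p"]) (simp only: mult.assoc[symmetric])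
qed

end

lemma half_nats_eq: "half_nats = range (\<lambda>n. real n / 2)"
  by (auto simp: half_nats_def)

theorem corollary1p3:
  fixes p :: real and \<mu> :: "(complex^2^2) measure"
  assumes "normalized_haar_SU2 \<mu>"
    and "2 \<le> p"
  shows "\<exists>C>0. \<forall>f :: real \<Rightarrow> complex.
    integrable (conj_haar \<mu>) f \<longrightarrow>
    (\<lambda>l. (2 * l + 1) powr (5 * p - 8) * norm (fourier_coeff (conj_haar \<mu>) f l) powr p)
      summable_on half_nats \<longrightarrow>
    f \<in> Lp_space (conj_haar \<mu>) p \<and>
    Lp_norm (conj_haar \<mu>) p f \<le>
      C * (\<Sum>\<^sub>\<infinity>l\<in>half_nats. (2 * l + 1) powr (5 * p - 8)
             * norm (fourier_coeff (conj_haar \<mu>) f l) powr p) powr (1 / p)"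
proof -
  interpret haar_SU2 \<mu> by unfold_locales fact
  obtain C where C: "C > 0"
    "\<And>f. integrable (conj_haar \<mu>) f \<Longrightarrow>
       summable (\<lambda>n. real (Suc n) powr (4 * p - 8) * cmod (characters.coef f n) powr p) \<Longrightarrow>
       integrable (conj_haar \<mu>) (\<lambda>x. cmod (f x) powr p) \<and>
       (\<integral>x. cmod (f x) powr p \<partial>conj_haar \<mu>)
         \<le> C * (\<Sum>n. real (Suc n) powr (4 * p - 8) * cmod (characters.coef f n) powr p)"
    using characters.lp_bound_of_coef[OF assms(2)] by blast
  show ?thesis
  proof (intro exI[of _ "C powr (1 / p)"] conjI allI impI)
    show "C powr (1 / p) > 0" using C(1) by simp
    fix f :: "real \<Rightarrow> complex"
    let ?g = "\<lambda>l. (2 * l + 1) powr (5 * p - 8) * norm (fourier_coeff (conj_haar \<mu>) f l) powr p"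
    define b where "b n = real (Suc n) powr (4 * p - 8) * cmod (characters.coef f n) powr p" for n
    assume f: "integrable (conj_haar \<mu>) f" and sum: "?g summable_on half_nats"
    \<comment> \<open>Reindexing by \<open>l = n / 2\<close> turns the unordered sum over
      \<open>half_nats\<close> into a series over the naturals.\<close>
    have inj: "inj (\<lambda>n. real n / 2)" by (auto intro: injI)
    have gb: "?g \<circ> (\<lambda>n. real n / 2) = b"
      unfolding b_def by (rule ext) (simp only: o_apply weighted_fourier_coeff_eq)
    have b_on: "b summable_on UNIV"
      using sum unfolding half_nats_eq summable_on_reindex[OF inj] gb .
    have "infsum ?g half_nats = infsum b UNIV"
      unfolding half_nats_eq infsum_reindex[OF inj] gb ..
    also have "\<dots> = suminf b"
      using has_sum_imp_sums[OF has_sum_infsum[OF b_on]] by (rule sums_unique)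
    finally have infsum: "infsum ?g half_nats = suminf b" .
    have b: "summable b" using b_on by (rule summable_on_imp_summable)
    have *: "integrable (conj_haar \<mu>) (\<lambda>x. cmod (f x) powr p)"
      "(\<integral>x. cmod (f x) powr p \<partial>conj_haar \<mu>) \<le> C * suminf b"
      using C(2)[OF f] b unfolding b_def by blast+
    show "f \<in> Lp_space (conj_haar \<mu>) p"
      using f *(1) by (simp add: Lp_space_def borel_measurable_integrable)
    have "Lp_norm (conj_haar \<mu>) p f \<le> (C * suminf b) powr (1 / p)"
      unfolding Lp_norm_def using *(2) assms(2) by (intro powr_mono2) auto
    also have "\<dots> = C powr (1 / p) * suminf b powr (1 / p)"
      by (rule powr_mult)
    finally show "Lp_norm (conj_haar \<mu>) p f \<le> C powr (1 / p) * infsum ?g half_nats powr (1 / p)"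
      unfolding infsum .
  qed
qed

end
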